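(* Under the standing assumptions stated in the context, the optimal control problem (P) admits at least one solution, i.e., there is a feasible control $u^*$ with associated state $x^*$ such that $J(x^*,u^* )\le J(x,u)$ for every feasible control $u$ with associated state $x$.
   Context: Let $n,m\ge1$, $T>0$, $\tau>0$, $I=[0,T]$, $I_\tau=[-\tau,T]$. For $x\in C(I_\tau;\mathbb{R}^n)$ and $t\in I$, $\max x_t:=\max_{s\in[t-\tau,t]}x(s)$ componentwise. Standing assumptions: $F(x,v,u)=F_0(x,v)+F_1(x,v)u$ with $F_0:\mathbb{R}^n\times\mathbb{R}^n\to\mathbb{R}^n$, $F_1:\mathbb{R}^n\times\mathbb{R}^n\to\mathbb{R}^{n\times m}$ globally Lipschitz continuous and continuously differentiable; $\phi\in C([-\tau,0];\mathbb{R}^n)$; $U\subset\mathbb{R}^m$ nonempty, convex and compact; $j:I\times\mathbb{R}^n\times\mathbb{R}^m\to\mathbb{R}$ a nonnegative normal integrand, convex in its third argument, differentiable in its second argument with derivative continuous in the second and third arguments. For $u\in L^\infty(I;\mathbb{R}^m)$ the associated state is the unique $x\in C(I_\tau;\mathbb{R}^n)\cap W^{1,\infty}(I;\mathbb{R}^n)$ with $x'(t)=F(x(t),\max x_t,u(t))$ for a.e. $t\in(0,T)$ and $x=\phi$ on $[-\tau,0]$. A control $u\in L^\infty(I;\mathbb{R}^m)$ is feasible if $u(t)\in U$ for a.e. $t\in I$. Problem (P): minimize $J(x,u)=\int_0^T j(t,x(t),u(t))\,\mathrm{d}t$ over feasible controls $u$ with associated states $x$. *)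

theory Defs
  imports "HOL-Analysis.Analysis"
begin

definition lsc :: "('a::topological_space \<Rightarrow> real) \<Rightarrow> bool" where
  "lsc f \<longleftrightarrow> (\<forall>p. \<forall>a. a < f p \<longrightarrow> (\<forall>\<^sub>F q in nhds p. a < f q))"

definition normal_integrand ::
  "real \<Rightarrow> (real \<Rightarrow> real^'n \<Rightarrow> real^'m \<Rightarrow> real) \<Rightarrow> bool" where
  "normal_integrand T j \<longleftrightarrow>
     (\<lambda>(t, x, u). j t x u) \<in> borel_measurable
        (restrict_space lebesgue {0..T} \<Otimes>\<^sub>M (borel \<Otimes>\<^sub>M borel))
   \<and> (\<forall>t\<in>{0..T}. lsc (\<lambda>(x, u). j t x u))"

definition C1_map :: "('a::euclidean_space \<Rightarrow> 'b::euclidean_space) \<Rightarrow> bool" where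
  "C1_map f \<longleftrightarrow> (\<exists>D :: 'a \<Rightarrow> ('a \<Rightarrow>\<^sub>L 'b).
      (\<forall>p. (f has_derivative blinfun_apply (D p)) (at p)) \<and> continuous_on UNIV D)"

definition maxdel :: "real \<Rightarrow> (real \<Rightarrow> real^'n) \<Rightarrow> real \<Rightarrow> real^'n" where
  "maxdel \<tau> x t = (\<chi> i. (SUP s\<in>{t - \<tau>..t}. x s $ i))"

definition rhs :: "(real^'n \<Rightarrow> real^'n \<Rightarrow> real^'n) \<Rightarrow> (real^'n \<Rightarrow> real^'n \<Rightarrow> real^'m^'n)
     \<Rightarrow> real^'n \<Rightarrow> real^'n \<Rightarrow> real^'m \<Rightarrow> real^'n" where
  "rhs F0 F1 x v u = F0 x v + F1 x v *v u"

definition Linf :: "real \<Rightarrow> (real \<Rightarrow> real^'m) \<Rightarrow> bool" where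
  "Linf T u \<longleftrightarrow> u \<in> borel_measurable (restrict_space lebesgue {0..T})
     \<and> (\<exists>C. AE t in lebesgue. t \<in> {0..T} \<longrightarrow> norm (u t) \<le> C)"

definition feasible :: "real \<Rightarrow> (real^'m) set \<Rightarrow> (real \<Rightarrow> real^'m) \<Rightarrow> bool" where
  "feasible T U u \<longleftrightarrow> Linf T u \<and> (AE t in lebesgue. t \<in> {0..T} \<longrightarrow> u t \<in> U)"

text \<open>x is the state associated with u: x continuous on [-tau,T], x in W^{1,infty}(I)
  (i.e. Lipschitz on I), x'(t) = F(x(t), max x_t, u(t)) for a.e. t in (0,T),
  and x = phi on [-tau,0].\<close>
definition is_state :: "real \<Rightarrow> real \<Rightarrow> (real \<Rightarrow> real^'n)
     \<Rightarrow> (real^'n \<Rightarrow> real^'n \<Rightarrow> real^'n) \<Rightarrow> (real^'n \<Rightarrow> real^'n \<Rightarrow> real^'m^'n)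
     \<Rightarrow> (real \<Rightarrow> real^'m) \<Rightarrow> (real \<Rightarrow> real^'n) \<Rightarrow> bool" where
  "is_state T \<tau> \<phi> F0 F1 u x \<longleftrightarrow>
     continuous_on {-\<tau>..T} x
   \<and> (\<exists>L. L-lipschitz_on {0..T} x)
   \<and> (AE t in lebesgue. t \<in> {0<..<T} \<longrightarrow>
        (x has_vector_derivative rhs F0 F1 (x t) (maxdel \<tau> x t) (u t)) (at t))
   \<and> (\<forall>s\<in>{-\<tau>..0}. x s = \<phi> s)"

definition cost :: "real \<Rightarrow> (real \<Rightarrow> real^'n \<Rightarrow> real^'m \<Rightarrow> real)
     \<Rightarrow> (real \<Rightarrow> real^'n) \<Rightarrow> (real \<Rightarrow> real^'m) \<Rightarrow> ennreal" where
  "cost T j x u = (\<integral>\<^sup>+ t\<in>{0..T}. ennreal (j t (x t) (u t)) \<partial>lebesgue)"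

end

theory Submission
  imports Defs "HOL-Complex_Analysis.Great_Picard"
begin

text \<open>Direct method without weak topologies. Along a minimizing sequence of controls the states are
  uniformly bounded and equicontinuous, so a subsequence converges uniformly. Suitable convex
  combinations of the tails of the bounded controls converge almost everywhere. Since the right-hand
  side is affine in the control, the limit control drives the limit state. Since the integrand is
  convex in the control and, locally uniformly in the control, Lipschitz in the state, it lies
  pointwise below the lower limit of the convex combinations of the integrands, and Fatou's lemma
  bounds its integral by the infimum. Existence of at least one state and the uniform bound both come
  from an exponentially weighted sup norm in which the integral operator has norm at most 1/2.\<close>

section \<open>Almost everywhere convergent convex combinations\<close>

text \<open>The state enters the right-hand side nonlinearly, so a convex combination of
  trajectories need not be a trajectory. Hence controls, velocities and integrands are combined with
  the same weights, while the states enter only through their limit: each velocity is compared with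
  the one at the limit state under the same control, with an error that does not depend on the
  control. Combining tails, rather than initial segments, preserves every limit obtained before.
  Statements that hold only almost everywhere have two costs. Controls are changed on null sets so
  as to take values in \<open>U\<close> everywhere, and the differential form of the state equation
  is exchanged with its integral form in both directions, by a fundamental theorem of calculus for
  Lipschitz functions and by Lebesgue differentiation. Costs are extended nonnegative reals, so an
  infinite infimum is no special case.\<close>

definition conv_weights :: "nat \<Rightarrow> nat \<Rightarrow> (nat \<Rightarrow> real) \<Rightarrow> bool" where
  "conv_weights k N w \<longleftrightarrow> (\<forall>i. 0 \<le> w i) \<and> (\<forall>i. i \<notin> {k..N} \<longrightarrow> w i = 0) \<and> sum w {k..N} = 1"

text \<open>Weights vanish outside \<open>{k..N}\<close>, so the index range can be widened freely;
  this puts combinations of different tails on a common range.\<close>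

lemma conv_weights_sum_eq:
  fixes f :: "nat \<Rightarrow> 'a::real_vector"
  assumes "conv_weights k N w" "k' \<le> k" "N \<le> N'"
  shows "(\<Sum>i=k'..N'. w i *\<^sub>R f i) = (\<Sum>i=k..N. w i *\<^sub>R f i)"
  using assms by (intro sum.mono_neutral_right) (auto simp: conv_weights_def)

lemma conv_weights_mono:
  assumes "conv_weights k N w" "k' \<le> k" "N \<le> N'"
  shows "conv_weights k' N' w"
  using conv_weights_sum_eq[OF assms, of "\<lambda>_. 1::real"] assms
  by (auto simp: conv_weights_def)

lemma conv_weights_midpoint:
  assumes "conv_weights k N v" "conv_weights k N w"
  shows "conv_weights k N (\<lambda>i. (v i + w i) / 2)"
  using assms by (auto simp: conv_weights_def sum.distrib simp flip: sum_divide_distrib)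

lemma conv_weights_mem_convex:
  fixes f :: "nat \<Rightarrow> 'a::real_vector"
  assumes "conv_weights k N w" "convex S" "\<And>i. k \<le> i \<Longrightarrow> f i \<in> S"
  shows "(\<Sum>i=k..N. w i *\<^sub>R f i) \<in> S"
  using assms by (intro convex_sum) (auto simp: conv_weights_def)

text \<open>Balls are convex: a ball around the limit that contains a tail of \<open>f\<close> also
  contains all combinations of that tail.\<close>

lemma conv_weights_tendsto:
  fixes f :: "nat \<Rightarrow> 'a::real_normed_vector"
  assumes w: "\<And>k. conv_weights k (N k) (w k)" and f: "f \<longlonglongrightarrow> l"
  shows "(\<lambda>k. \<Sum>i=k..N k. w k i *\<^sub>R f i) \<longlonglongrightarrow> l"
proof (rule LIMSEQ_I)
  fix e :: real assume e: "0 < e"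
  obtain m where m: "\<And>i. m \<le> i \<Longrightarrow> f i \<in> ball l e"
    using LIMSEQ_D[OF f e] by (auto simp: dist_norm norm_minus_commute)
  have "(\<Sum>i=k..N k. w k i *\<^sub>R f i) \<in> ball l e" if "m \<le> k" for k
    by (rule conv_weights_mem_convex[OF w convex_ball]) (use m that in auto)
  then show "\<exists>no. \<forall>k\<ge>no. norm ((\<Sum>i=k..N k. w k i *\<^sub>R f i) - l) < e"
    by (auto simp: dist_norm norm_minus_commute)
qed

lemma norm_sq_diff_parallelogram:
  fixes a b :: "'a::real_inner"
  shows "(norm (a - b))\<^sup>2 = 2 * (norm a)\<^sup>2 + 2 * (norm b)\<^sup>2 - 4 * (norm ((a + b) /\<^sub>R 2))\<^sup>2"
  by (simp add: power2_norm_eq_inner inner_simps algebra_simps inner_commute)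

text \<open>On a finite measure space the squared norms control the integrals of the increments;
  these are summable, so the telescoping series converges absolutely almost everywhere.\<close>

lemma (in finite_measure) AE_convergent_of_fast_Cauchy_L2:
  fixes g :: "nat \<Rightarrow> 'a \<Rightarrow> 'b::euclidean_space"
  assumes meas[measurable]: "\<And>k. g k \<in> borel_measurable M"
    and int: "\<And>k. integrable M (\<lambda>x. (norm (g (Suc k) x - g k x))\<^sup>2)"
    and fast: "\<And>k. (\<integral>x. (norm (g (Suc k) x - g k x))\<^sup>2 \<partial>M) \<le> (1/4) ^ k"
  shows "AE x in M. convergent (\<lambda>k. g k x)"
proof -
  define d where "d k x = norm (g (Suc k) x - g k x)" for k x
  have d_meas[measurable]: "d k \<in> borel_measurable M" for k
    unfolding d_def by measurable
  have d_int: "(\<integral>\<^sup>+x. ennreal (d k x) \<partial>M) \<le> ennreal ((1 + measure M (space M)) * (1/2) ^ k)" for k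
  proof -
    \<comment> \<open>Young's inequality with weight \<open>2 ^ k\<close>, the balance that turns
      the rate \<open>(1/4) ^ k\<close> for squares into the summable rate
      \<open>(1/2) ^ k\<close>.\<close>
    have "d k x \<le> 2 ^ k * (d k x)\<^sup>2 + (1/2) ^ k" for x
    proof -
      have "0 \<le> (2 ^ k * d k x - 1)\<^sup>2" by simp
      also have "\<dots> = 2 ^ k * (2 ^ k * (d k x)\<^sup>2 - 2 * d k x + (1/2) ^ k)"
        by (simp add: power2_eq_square algebra_simps power_one_over)
      finally have "0 \<le> 2 ^ k * (d k x)\<^sup>2 - 2 * d k x + (1/2) ^ k"
        using zero_le_mult_iff[of "2 ^ k :: real"] by (meson not_less zero_less_numeral zero_less_power)
      moreover have "0 \<le> d k x" by (simp add: d_def)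
      ultimately show ?thesis by linarith
    qed
    then have "(\<integral>\<^sup>+x. ennreal (d k x) \<partial>M) \<le> (\<integral>\<^sup>+x. ennreal (2 ^ k * (d k x)\<^sup>2 + (1/2) ^ k) \<partial>M)"
      by (intro nn_integral_mono ennreal_leI)
    also have "\<dots> = ennreal (\<integral>x. 2 ^ k * (d k x)\<^sup>2 + (1/2) ^ k \<partial>M)"
      using int[of k] by (intro nn_integral_eq_integral) (auto simp: d_def)
    also have "(\<integral>x. 2 ^ k * (d k x)\<^sup>2 + (1/2) ^ k \<partial>M)
        = 2 ^ k * (\<integral>x. (d k x)\<^sup>2 \<partial>M) + (1/2) ^ k * measure M (space M)"
      using int[of k] by (subst Bochner_Integration.integral_add) (auto simp: d_def mult.commute)
    also have "\<dots> \<le> 2 ^ k * (1/4) ^ k + (1/2) ^ k * measure M (space M)"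
      using fast[of k] by (intro add_mono mult_left_mono) (auto simp: d_def)
    also have "\<dots> = (1 + measure M (space M)) * (1/2) ^ k"
      by (simp add: algebra_simps flip: power_mult_distrib)
    finally show ?thesis by (simp add: ennreal_leI)
  qed
  have "(\<integral>\<^sup>+x. (\<Sum>k. ennreal (d k x)) \<partial>M) = (\<Sum>k. \<integral>\<^sup>+x. ennreal (d k x) \<partial>M)"
    by (rule nn_integral_suminf) simp
  also have "\<dots> \<le> (\<Sum>k. ennreal ((1 + measure M (space M)) * (1/2) ^ k))"
    by (intro suminf_le d_int) auto
  also have "\<dots> < \<infinity>"
    by (subst suminf_ennreal2) (auto intro!: summable_mult summable_geometric simp: add_nonneg_nonneg)
  finally have "AE x in M. (\<Sum>k. ennreal (d k x)) \<noteq> \<infinity>"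
    by (intro nn_integral_PInf_AE) auto
  then show ?thesis
  proof eventually_elim
    case (elim x)
    then have "summable (\<lambda>k. d k x)"
      by (intro summable_suminf_not_top) (auto simp: d_def)
    then have "summable (\<lambda>k. g (Suc k) x - g k x)"
      unfolding d_def by (rule summable_norm_cancel)
    then have "convergent (\<lambda>n. \<Sum>k<n. g (Suc k) x - g k x)"
      by (simp add: summable_iff_convergent)
    then have "convergent (\<lambda>n. g n x - g 0 x)"
      using sum_lessThan_telescope[of "\<lambda>n. g n x"] by simp
    then have "convergent (\<lambda>n. (g n x - g 0 x) + g 0 x)"
      by (rule convergent_add) (simp add: convergent_const)
    then show ?case by simp
  qed
qed

text \<open>A weak-compactness substitute: elements of almost minimal \<open>L\<^sup>2\<close> norm in the convex hulls of
  the tails form a Cauchy sequence by the parallelogram law.\<close>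

lemma (in finite_measure) convex_combinations_AE_convergent:
  fixes f :: "nat \<Rightarrow> 'a \<Rightarrow> 'b::euclidean_space"
  assumes meas[measurable]: "\<And>k. f k \<in> borel_measurable M"
    and bound: "\<And>k x. norm (f k x) \<le> B"
  obtains N w where "\<And>k. conv_weights k (N k) (w k)"
    "AE x in M. convergent (\<lambda>k. \<Sum>i=k..N k. w k i *\<^sub>R f i x)"
proof -
  define g where "g k N w x = (\<Sum>i=k..N. w i *\<^sub>R f i x)" for k N w x
  define Q where "Q h = (\<integral>x. (norm (h x))\<^sup>2 \<partial>M)" for h :: "'a \<Rightarrow> 'b"
  define C where "C k = {Q (g k N w) |N w. conv_weights k N w}" for k
  \<comment> \<open>The hulls shrink, so \<open>a\<close> is nondecreasing; being bounded it
    converges, and its increments will bound the squared distances.\<close>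
  define a where "a k = Inf (C k)" for k
  have B: "0 \<le> B" using bound[of 0 undefined] norm_ge_zero order_trans by blast
  have g_meas[measurable]: "g k N w \<in> borel_measurable M" for k N w
    unfolding g_def by measurable
  have g_bound: "norm (g k N w x) \<le> B" if "conv_weights k N w" for k N w x
    using conv_weights_mem_convex[OF that convex_cball[of 0 B], of "\<lambda>i. f i x"] bound
    by (simp add: g_def)
  have sq_int: "integrable M (\<lambda>x. (norm (h x))\<^sup>2)"
    if "h \<in> borel_measurable M" "\<And>x. norm (h x) \<le> c" for h :: "'a \<Rightarrow> 'b" and c
    using that by (intro integrable_const_bound[of _ "c\<^sup>2"]) (auto intro!: power_mono)
  have Q_nonneg: "0 \<le> Q h" for h
    by (simp add: Q_def)
  have Q_le: "Q (g k N w) \<le> B\<^sup>2 * measure M (space M)" if "conv_weights k N w" for k N w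
  proof -
    have "Q (g k N w) \<le> (\<integral>x. B\<^sup>2 \<partial>M)"
      unfolding Q_def using g_bound[OF that]
      by (intro integral_mono sq_int[of _ B]) (auto intro!: power_mono)
    then show ?thesis by (simp add: mult.commute)
  qed
  have cw: "conv_weights k k (\<lambda>i. if i = k then 1 else 0)" for k
    by (auto simp: conv_weights_def)
  have C_ne: "C k \<noteq> {}" for k
    using cw[of k] by (auto simp: C_def)
  have C_bdd: "bdd_below (C k)" for k
    by (rule bdd_belowI[of _ 0]) (auto simp: C_def Q_nonneg)
  have a_le: "a k \<le> Q (g k N w)" if "conv_weights k N w" for k N w
    unfolding a_def using that by (intro cInf_lower C_bdd) (auto simp: C_def)
  have g_mono: "g k' N' w = g k N w" if "conv_weights k N w" "k' \<le> k" "N \<le> N'" for k k' N N' w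
    unfolding g_def by (rule ext) (rule conv_weights_sum_eq[OF that])
  have a_mono: "a k \<le> a l" if "k \<le> l" for k l
    unfolding a_def[of l]
  proof (rule cInf_greatest[OF C_ne])
    fix q assume "q \<in> C l"
    then obtain N w where q: "q = Q (g l N w)" and w: "conv_weights l N w"
      by (auto simp: C_def)
    show "a k \<le> q"
      using a_le[OF conv_weights_mono[OF w that order_refl]] g_mono[OF w that order_refl] q by simp
  qed
  have "a k \<le> B\<^sup>2 * measure M (space M)" for k
    using a_le[OF cw] Q_le[OF cw] order_trans by blast
  then have "convergent a"
    using incseq_convergent[of a] a_mono by (metis convergent_def incseq_def)
  have "\<exists>N w. conv_weights k N w \<and> Q (g k N w) < a k + 1 / Suc k" for k
  proof -
    have "\<exists>q\<in>C k. q < a k + 1 / Suc k"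
      using cInf_lessD[OF C_ne, of k "a k + 1 / Suc k"] by (auto simp: a_def)
    then show ?thesis by (auto simp: C_def)
  qed
  then obtain N w where w: "\<And>k. conv_weights k (N k) (w k)"
    and Q_less: "\<And>k. Q (g k (N k) (w k)) < a k + 1 / Suc k"
    by metis
  define h where "h k = g k (N k) (w k)" for k
  have h_meas[measurable]: "h k \<in> borel_measurable M" for k
    unfolding h_def by measurable
  have h_bound: "norm (h k x) \<le> B" for k x
    unfolding h_def by (rule g_bound[OF w])
  have diff_int: "integrable M (\<lambda>x. (norm (h l x - h k x))\<^sup>2)" for k l
  proof (rule sq_int)
    show "norm (h l x - h k x) \<le> 2 * B" for x
      using norm_triangle_ineq4[of "h l x" "h k x"] h_bound[of l x] h_bound[of k x] by linarith
  qed measurable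
  have Q_diff: "Q (\<lambda>x. h l x - h k x) \<le> 2 * (a l - a k) + 4 / Suc k" if kl: "k \<le> l" for k l
  proof -
    define N' where "N' = max (N k) (N l)"
    have wk: "conv_weights k N' (w k)" and wl: "conv_weights k N' (w l)"
      using conv_weights_mono[OF w[of k], of k N'] conv_weights_mono[OF w[of l] kl, of N']
      by (auto simp: N'_def)
    \<comment> \<open>As \<open>k \<le> l\<close>, the midpoint of \<open>h k\<close> and
      \<open>h l\<close> is again a combination of the tail from \<open>k\<close>, so its squared
      norm is at least \<open>a k\<close>. This is the lower bound that the parallelogram law
      needs.\<close>
    define v where "v i = (w k i + w l i) / 2" for i
    have v: "conv_weights k N' v"
      unfolding v_def by (rule conv_weights_midpoint[OF wk wl])
    have hk: "h k = g k N' (w k)" and hl: "h l = g k N' (w l)"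
      using g_mono[OF w[of k], of k N'] g_mono[OF w[of l] kl, of N'] by (auto simp: h_def N'_def)
    have mid: "g k N' v x = (h l x + h k x) /\<^sub>R 2" for x
      by (simp add: hk hl g_def v_def scaleR_sum_right scaleR_add_left sum.distrib add_divide_distrib
          scaleR_add_right add.commute)
    have "Q (\<lambda>x. h l x - h k x)
        = (\<integral>x. 2 * (norm (h l x))\<^sup>2 + 2 * (norm (h k x))\<^sup>2 - 4 * (norm (g k N' v x))\<^sup>2 \<partial>M)"
      unfolding Q_def by (simp add: norm_sq_diff_parallelogram mid)
    also have "\<dots> = 2 * Q (h l) + 2 * Q (h k) - 4 * Q (g k N' v)"
      unfolding Q_def
      using sq_int[OF h_meas h_bound] sq_int[OF g_meas g_bound[OF v]] by simp
    also have "\<dots> \<le> 2 * (a l + 1 / Suc l) + 2 * (a k + 1 / Suc k) - 4 * a k"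
      using Q_less[of k] Q_less[of l] a_le[OF v] by (simp add: h_def)
    also have "\<dots> \<le> 2 * (a l - a k) + 4 / Suc k"
    proof -
      have "1 / real (Suc l) \<le> 1 / Suc k" using kl by (simp add: frac_le)
      then show ?thesis by simp
    qed
    finally show ?thesis .
  qed
  have "\<exists>m. \<forall>k\<ge>m. \<forall>l\<ge>k. Q (\<lambda>x. h l x - h k x) \<le> e" if e: "0 < e" for e
  proof -
    obtain m1 where m1: "\<And>k l. m1 \<le> k \<Longrightarrow> m1 \<le> l \<Longrightarrow> dist (a l) (a k) < e / 4"
      using convergent_Cauchy[OF \<open>convergent a\<close>] e unfolding Cauchy_def
      by (metis divide_pos_pos zero_less_numeral)
    obtain m2 :: nat where m2: "8 / e < m2" using reals_Archimedean2 by blast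
    have "Q (\<lambda>x. h l x - h k x) \<le> e" if "max m1 m2 \<le> k" "k \<le> l" for k l
    proof -
      have "8 / e < Suc k" using m2 that by linarith
      then have "4 / real (Suc k) \<le> e / 2" using e by (simp add: field_simps)
      moreover have "\<bar>a l - a k\<bar> < e / 4" using m1[of k l] that unfolding dist_real_def by simp
      then have "a l - a k \<le> e / 4" using abs_ge_self[of "a l - a k"] by linarith
      then have "2 * (a l - a k) \<le> e / 2" by simp
      ultimately show ?thesis using Q_diff[OF \<open>k \<le> l\<close>] by linarith
    qed
    then show ?thesis by blast
  qed
  then have "\<forall>n. \<exists>m. \<forall>k\<ge>m. \<forall>l\<ge>k. Q (\<lambda>x. h l x - h k x) \<le> (1/4) ^ n"
    by simp
  then obtain m where m: "\<And>n k l. m n \<le> k \<Longrightarrow> k \<le> l \<Longrightarrow> Q (\<lambda>x. h l x - h k x) \<le> (1/4) ^ n"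
    by metis
  \<comment> \<open>The summand \<open>n\<close> makes weights on the tail from \<open>r n\<close>
    also weights on the tail from \<open>n\<close>; the sum of all earlier \<open>m i\<close> makes
    \<open>r\<close> monotone and at least \<open>m n\<close>.\<close>
  define r where "r n = n + (\<Sum>i\<le>n. m i)" for n
  have r: "m n \<le> r n" "n \<le> r n" "r n \<le> r (Suc n)" for n
    using member_le_sum[of n "{..n}" m] by (auto simp: r_def)
  have "AE x in M. convergent (\<lambda>n. h (r n) x)"
  proof (rule AE_convergent_of_fast_Cauchy_L2)
    show "(\<integral>x. (norm (h (r (Suc n)) x - h (r n) x))\<^sup>2 \<partial>M) \<le> (1/4) ^ n" for n
      using m[OF r(1) r(3), of n] by (simp add: Q_def)
  qed (auto intro: diff_int)
  then have "AE x in M. convergent (\<lambda>n. \<Sum>i=n..N (r n). w (r n) i *\<^sub>R f i x)"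
    unfolding h_def g_def
    by (simp add: conv_weights_sum_eq[OF w r(2) order_refl])
  moreover have "conv_weights n (N (r n)) (w (r n))" for n
    by (rule conv_weights_mono[OF w r(2) order_refl])
  ultimately show thesis by (rule that[rotated])
qed

section \<open>Lipschitz functions and their derivatives almost everywhere\<close>

lemma integrable_lebesgue_on_bounded:
  fixes g :: "real \<Rightarrow> 'a::euclidean_space"
  assumes "g \<in> borel_measurable (lebesgue_on {a..b})" "\<And>t. t \<in> {a..b} \<Longrightarrow> norm (g t) \<le> c"
  shows "integrable (lebesgue_on {a..b}) g"
  using assms
  by (intro finite_measure.integrable_const_bound[of _ _ c] finite_measure_lebesgue_on) auto

lemma has_vector_derivative_at_iff_quotient:
  fixes f :: "real \<Rightarrow> 'a::real_normed_vector"
  shows "(f has_vector_derivative f') (at t) \<longleftrightarrow> ((\<lambda>e. (f (t + e) - f t) /\<^sub>R e) \<longlongrightarrow> f') (at 0)"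
proof -
  have "(f has_vector_derivative f') (at t) \<longleftrightarrow>
      ((\<lambda>e. norm (f (t + e) - f t - e *\<^sub>R f') / norm e) \<longlongrightarrow> 0) (at 0)"
    by (simp add: has_vector_derivative_def has_derivative_at bounded_linear_scaleR_left)
  also have "\<dots> \<longleftrightarrow> ((\<lambda>e. norm ((f (t + e) - f t) /\<^sub>R e - f')) \<longlongrightarrow> 0) (at 0)"
  proof (rule filterlim_cong[OF refl refl])
    have "norm (f (t + e) - f t - e *\<^sub>R f') / norm e = norm ((f (t + e) - f t) /\<^sub>R e - f')"
      if "e \<noteq> 0" for e
    proof -
      have "(f (t + e) - f t) /\<^sub>R e - f' = (f (t + e) - f t - e *\<^sub>R f') /\<^sub>R e"
        using that by (simp add: scaleR_diff_right)
      then show ?thesis by (simp add: divide_inverse mult.commute)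
    qed
    then show "\<forall>\<^sub>F e in at 0. norm (f (t + e) - f t - e *\<^sub>R f') / norm e
        = norm ((f (t + e) - f t) /\<^sub>R e - f')"
      by (simp add: eventually_at_filter)
  qed
  also have "\<dots> \<longleftrightarrow> ((\<lambda>e. (f (t + e) - f t) /\<^sub>R e) \<longlongrightarrow> f') (at 0)"
    by (simp add: tendsto_norm_zero_iff LIM_zero_iff)
  finally show ?thesis .
qed

text \<open>The difference quotients converge boundedly almost everywhere, and their integrals are
  differences of difference quotients of a primitive of \<open>f\<close>.\<close>

lemma lipschitz_AE_derivative_integral:
  fixes f g :: "real \<Rightarrow> 'a::euclidean_space"
  assumes ab: "a \<le> b" and lip: "L-lipschitz_on {a..b} f"
    and deriv: "AE t in lebesgue. t \<in> {a<..<b} \<longrightarrow> (f has_vector_derivative g t) (at t)"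
    and int: "integrable (lebesgue_on {a..b}) g"
  shows "integral {a..b} g = f b - f a"
proof -
  \<comment> \<open>Constant continuation beyond \<open>[a, b]\<close> keeps the Lipschitz constant
    and gives a meaning to forward quotients near \<open>b\<close>.\<close>
  define F where "F t = f (max a (min t b))" for t
  have F_eq: "F t = f t" if "t \<in> {a..b}" for t
    using that by (simp add: F_def)
  have L: "0 \<le> L" using lip by (rule lipschitz_on_nonneg)
  have F_lip: "norm (F s - F t) \<le> L * \<bar>s - t\<bar>" for s t
  proof -
    have "norm (F s - F t) \<le> L * \<bar>max a (min s b) - max a (min t b)\<bar>"
      using lipschitz_onD[OF lip, of "max a (min s b)" "max a (min t b)"] ab
      by (auto simp: F_def dist_norm)
    also have "\<dots> \<le> L * \<bar>s - t\<bar>" using L by (intro mult_left_mono) auto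
    finally show ?thesis .
  qed
  have "L-lipschitz_on UNIV F"
    using F_lip L by (intro lipschitz_onI) (auto simp: dist_norm)
  then have F_cont: "continuous_on S F" for S
    using lipschitz_on_continuous_on continuous_on_subset by blast
  \<comment> \<open>Starting at \<open>a - 1\<close> makes \<open>a\<close> an interior point; the
    right end \<open>b + 2\<close> leaves room for \<open>b + d n\<close>, since
    \<open>d n \<le> 1\<close>.\<close>
  define P where "P t = integral {a - 1..t} F" for t
  have P: "(P has_vector_derivative F t) (at t)" if "t \<in> {a - 1<..<b + 2}" for t
    using integral_has_vector_derivative[OF F_cont[of "{a - 1..b + 2}"], of t] that
    by (simp add: P_def[abs_def] at_within_Icc_at)
  define d where "d n = 1 / real (Suc n)" for n
  have d: "0 < d n" "d n \<le> 1" for n by (auto simp: d_def)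
  have d_lim: "d \<longlonglongrightarrow> 0"
    unfolding d_def using LIMSEQ_inverse_real_of_nat by (simp add: inverse_eq_divide)
  have d_at: "filterlim d (at 0) sequentially"
    using d_lim d(1) by (auto simp: filterlim_at intro!: always_eventually less_imp_neq[symmetric])
  define q where "q n t = (F (t + d n) - F t) /\<^sub>R d n" for n t
  have quot: "(\<lambda>n. (h (t + d n) - h t) /\<^sub>R d n) \<longlonglongrightarrow> h'"
    if "(h has_vector_derivative h') (at t)" for h :: "real \<Rightarrow> 'a" and h' t
    using filterlim_compose[OF that[unfolded has_vector_derivative_at_iff_quotient] d_at] .
  have q_integral: "integral {a..b} (q n) = (P (b + d n) - P b) /\<^sub>R d n - (P (a + d n) - P a) /\<^sub>R d n"
    for n
  proof -
    \<comment> \<open>\<open>S\<close> is a classical primitive of the quotient \<open>q n\<close>,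
      because \<open>F\<close> is continuous; no almost everywhere argument enters here.\<close>
    define S where "S t = (P (t + d n) - P t) /\<^sub>R d n" for t
    have "(S has_vector_derivative q n t) (at t within {a..b})" if "t \<in> {a..b}" for t
    proof -
      have "((\<lambda>t. t + d n) has_vector_derivative 1) (at t)"
        by (auto intro!: derivative_eq_intros)
      then have "((\<lambda>t. P (t + d n)) has_vector_derivative F (t + d n)) (at t)"
        using vector_diff_chain_at[of "\<lambda>t. t + d n" 1 t P "F (t + d n)"] P[of "t + d n"] d[of n] that
        by (simp add: o_def)
      moreover have "(P has_vector_derivative F t) (at t)" using P[of t] that by simp
      ultimately have "((\<lambda>t. P (t + d n) - P t) has_vector_derivative F (t + d n) - F t) (at t)"
        by (rule has_vector_derivative_diff)
      from bounded_linear.has_vector_derivative[OF bounded_linear_scaleR_right this]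
      show ?thesis
        unfolding S_def[abs_def] q_def by (rule has_vector_derivative_at_within)
    qed
    then have "(q n has_integral (S b - S a)) {a..b}"
      by (intro fundamental_theorem_of_calculus ab)
    then show ?thesis by (simp add: integral_unique S_def)
  qed
  have "(\<lambda>n. integral {a..b} (q n)) \<longlonglongrightarrow> F b - F a"
    unfolding q_integral using P[of a] P[of b] ab by (intro tendsto_diff quot) auto
  moreover have "(\<lambda>n. integral {a..b} (q n)) \<longlonglongrightarrow> integral {a..b} g"
  proof -
    have q_cont: "continuous_on {a..b} (q n)" for n
    proof -
      have "continuous_on {a..b} (\<lambda>t. F (t + d n))"
        by (rule continuous_on_compose2[OF F_cont[of UNIV]]) (auto intro!: continuous_intros)
      then show ?thesis
        unfolding q_def[abs_def] by (intro continuous_intros F_cont)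
    qed
    have q_meas: "q n \<in> borel_measurable (lebesgue_on {a..b})" for n
      by (intro continuous_imp_measurable_on_sets_lebesgue q_cont) auto
    have conv: "AE t in lebesgue_on {a..b}. (\<lambda>n. q n t) \<longlonglongrightarrow> g t"
    proof -
      have "AE t in lebesgue. t \<notin> {a, b}"
        by (intro AE_not_in) (simp flip: negligible_iff_null_sets)
      with deriv have "AE t in lebesgue. t \<in> {a..b} \<longrightarrow> (\<lambda>n. q n t) \<longlonglongrightarrow> g t"
      proof eventually_elim
        case (elim t)
        show ?case
        proof
          assume "t \<in> {a..b}"
          then have t: "t \<in> {a<..<b}" using elim by auto
          have "(F has_vector_derivative g t) (at t)"
            by (rule has_vector_derivative_transform_within_open[of f _ _ "{a<..<b}"])
               (use elim t in \<open>auto simp: F_eq\<close>)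
          then show "(\<lambda>n. q n t) \<longlonglongrightarrow> g t"
            unfolding q_def by (rule quot)
        qed
      qed
      then show ?thesis by (subst AE_restrict_space_iff) auto
    qed
    have bnd: "norm (q n t) \<le> L" for n t
    proof -
      have "norm (q n t) = norm (F (t + d n) - F t) / d n"
        using d[of n] by (simp add: q_def divide_inverse mult.commute)
      then show ?thesis using F_lip[of "t + d n" t] d[of n] by (simp add: pos_divide_le_eq)
    qed
    have "(\<lambda>n. integral\<^sup>L (lebesgue_on {a..b}) (q n)) \<longlonglongrightarrow> integral\<^sup>L (lebesgue_on {a..b}) g"
      using int q_meas conv bnd
      by (intro integral_dominated_convergence[where w = "\<lambda>_. L"]) auto
    moreover have "integral\<^sup>L (lebesgue_on {a..b}) (q n) = integral {a..b} (q n)" for n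
      by (intro lebesgue_integral_eq_integral integrable_lebesgue_on_bounded[of _ _ _ L] q_meas bnd) auto
    moreover have "integral\<^sup>L (lebesgue_on {a..b}) g = integral {a..b} g"
      by (intro lebesgue_integral_eq_integral int) auto
    ultimately show ?thesis by simp
  qed
  ultimately have "integral {a..b} g = F b - F a"
    using LIMSEQ_unique by blast
  then show ?thesis using ab by (simp add: F_eq)
qed

text \<open>\<open>integrable_ccontinuous_explicit\<close> concerns averages over
  \<open>{t..t + h}\<close> with \<open>0 < h\<close>, hence right derivatives. Left derivatives
  come from the same result for the reflected function.\<close>

lemma indefinite_integral_AE_has_vector_derivative:
  fixes g :: "real \<Rightarrow> 'a::euclidean_space"
  assumes int: "g integrable_on {a..b}"
  shows "AE t in lebesgue. t \<in> {a<..<b} \<longrightarrow>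
    ((\<lambda>t. integral {a..t} g) has_vector_derivative g t) (at t)"
proof -
  \<comment> \<open>Extension by zero makes the function integrable on every interval, for both
    orientations.\<close>
  define G where "G t = (if t \<in> {a..b} then g t else 0)" for t
  have G_UNIV: "G integrable_on UNIV"
    unfolding G_def[abs_def] using int integrable_restrict_UNIV by blast
  have G_int: "G integrable_on {c..d}" for c d
    using integrable_on_subcbox[OF G_UNIV, of c d] by simp
  have G'_int: "(\<lambda>s. G (- s)) integrable_on {c..d}" for c d
    using Henstock_Kurzweil_Integration.integrable_reflect_real[where f = G and a = "- d" and b = "- c"]
      G_int[of "- d" "- c"] by simp
  obtain N where N: "negligible N" "\<And>t e. t \<notin> N \<Longrightarrow> 0 < e \<Longrightarrow>
      \<exists>d>0. \<forall>h. 0 < h \<and> h < d \<longrightarrow> norm (integral {t..t + h} G /\<^sub>R h - G t) < e"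
    using integrable_ccontinuous_explicit[of G] G_int by (simp add: Basis_real_def) metis
  obtain N' where N': "negligible N'" "\<And>t e. t \<notin> N' \<Longrightarrow> 0 < e \<Longrightarrow>
      \<exists>d>0. \<forall>h. 0 < h \<and> h < d \<longrightarrow> norm (integral {t..t + h} (\<lambda>s. G (- s)) /\<^sub>R h - G (- t)) < e"
    using integrable_ccontinuous_explicit[of "\<lambda>s. G (- s)"] G'_int by (simp add: Basis_real_def) metis
  \<comment> \<open>\<open>N'\<close> lives in reflected time and must be reflected back to join
    \<open>N\<close>.\<close>
  have "negligible (uminus ` N')"
    using N'(1) by (intro negligible_differentiable_image_negligible derivative_intros) auto
  then have "negligible (N \<union> uminus ` N')" using N(1) by simp
  then have "AE t in lebesgue. t \<notin> N \<union> uminus ` N'"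
    by (intro AE_not_in) (simp add: negligible_iff_null_sets)
  then show ?thesis
  proof eventually_elim
    case (elim t)
    show ?case
    proof
      assume t: "t \<in> {a<..<b}"
      define P where "P s = integral {a..s} g" for s
      have P_diff: "P s - P r = integral {r..s} G" if "a \<le> r" "r \<le> s" "s \<le> b" for r s
      proof -
        have "P r + integral {r..s} g = P s"
          unfolding P_def using that int
          by (intro Henstock_Kurzweil_Integration.integral_combine integrable_subinterval_real[OF int]) auto
        moreover have "integral {r..s} g = integral {r..s} G"
          using that by (intro integral_cong) (auto simp: G_def)
        ultimately show ?thesis by (simp add: algebra_simps)
      qed
      have "((\<lambda>e. (P (t + e) - P t) /\<^sub>R e) \<longlongrightarrow> g t) (at 0)"
      proof (rule LIM_I)
        fix e :: real assume e: "0 < e"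
        obtain d where d: "0 < d" "\<And>h. 0 < h \<Longrightarrow> h < d \<Longrightarrow> norm (integral {t..t + h} G /\<^sub>R h - G t) < e"
          using N(2)[of t e] elim e by blast
        have "- t \<notin> N'" using elim by force
        then obtain d' where d': "0 < d'"
          "\<And>h. 0 < h \<Longrightarrow> h < d' \<Longrightarrow> norm (integral {- t..- t + h} (\<lambda>s. G (- s)) /\<^sub>R h - G t) < e"
          using N'(2)[of "- t" e] e by auto
        have Gt: "G t = g t" using t by (simp add: G_def)
        \<comment> \<open>The last two entries keep \<open>t + h\<close> inside
          \<open>[a, b]\<close>, where \<open>g\<close> and \<open>G\<close> agree.\<close>
        define D where "D = Min {d, d', t - a, b - t}"
        have D: "0 < D" "D \<le> d" "D \<le> d'" "D \<le> t - a" "D \<le> b - t"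
          using d(1) d'(1) t by (auto simp: D_def)
        have "norm ((P (t + h) - P t) /\<^sub>R h - g t) < e" if "h \<noteq> 0" "\<bar>h\<bar> < D" for h
        proof (cases "0 < h")
          case True
          then show ?thesis using P_diff[of t "t + h"] d(2)[of h] D that t Gt by simp
        next
          case False
          define k where "k = - h"
          have k: "0 < k" "h = - k" using False that by (auto simp: k_def)
          have "integral {- t..- t + k} (\<lambda>s. G (- s)) = integral {t - k..t} G"
            using Henstock_Kurzweil_Integration.integral_reflect_real[where f = G and a = "t - k" and b = t] by (simp add: algebra_simps)
          moreover have "(P (t + h) - P t) /\<^sub>R h = integral {t - k..t} G /\<^sub>R k"
            using P_diff[of "t - k" t] k D that t by (simp flip: scaleR_minus_right)
          ultimately show ?thesis using d'(2)[of k] k D that Gt by simp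
        qed
        then show "\<exists>s>0. \<forall>h. h \<noteq> 0 \<and> norm (h - 0) < s \<longrightarrow> norm ((P (t + h) - P t) /\<^sub>R h - g t) < e"
          using D(1) by auto
      qed
      then show "((\<lambda>t. integral {a..t} g) has_vector_derivative g t) (at t)"
        unfolding has_vector_derivative_at_iff_quotient P_def .
    qed
  qed
qed

section \<open>The maximum over the delay interval\<close>

lemma norm_le_card_mult_cart:
  fixes x :: "real^'n"
  assumes "\<And>i. \<bar>x $ i\<bar> \<le> e"
  shows "norm x \<le> real CARD('n) * e"
  using order_trans[OF norm_le_l1_cart sum_bounded_above[of UNIV "\<lambda>i. \<bar>x $ i\<bar>" e]] assms by simp

lemma cSUP_diff_le:
  fixes f g :: "'a \<Rightarrow> real"
  assumes "S \<noteq> {}" "bdd_above (f ` S)" "bdd_above (g ` S)"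
    and "\<And>s. s \<in> S \<Longrightarrow> \<bar>f s - g s\<bar> \<le> e"
  shows "\<bar>(SUP s\<in>S. f s) - (SUP s\<in>S. g s)\<bar> \<le> e"
proof -
  have "(SUP s\<in>S. f s) \<le> (SUP s\<in>S. g s) + e"
    using assms(4) cSUP_upper[OF _ assms(3)]
    by (intro cSUP_least[OF assms(1)]) (smt (verit))
  moreover have "(SUP s\<in>S. g s) \<le> (SUP s\<in>S. f s) + e"
    using assms(4) cSUP_upper[OF _ assms(2)]
    by (intro cSUP_least[OF assms(1)]) (smt (verit))
  ultimately show ?thesis by linarith
qed

text \<open>Two times and two paths are allowed at once: equal times give Lipschitz dependence on
  the path, equal paths give continuity in time.\<close>

lemma maxdel_shift_diff_le:
  fixes x y :: "real \<Rightarrow> real^'n"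
  assumes \<tau>: "0 \<le> \<tau>" and x: "continuous_on {t - \<tau>..t} x" and y: "continuous_on {s - \<tau>..s} y"
    and e: "\<And>r. r \<in> {-\<tau>..0} \<Longrightarrow> norm (x (t + r) - y (s + r)) \<le> e"
  shows "norm (maxdel \<tau> x t - maxdel \<tau> y s) \<le> real CARD('n) * e"
proof (rule norm_le_card_mult_cart)
  fix i
  \<comment> \<open>Both delay windows are reindexed by \<open>{-\<tau>..0}\<close>, so that the
    suprema range over the same set and can be compared pointwise.\<close>
  have img: "(\<lambda>r. z r $ i) ` {p - \<tau>..p} = (\<lambda>r. z (p + r) $ i) ` {-\<tau>..0}"
    for z :: "real \<Rightarrow> real^'n" and p
  proof -
    have "{p - \<tau>..p} = (\<lambda>r. p + r) ` {-\<tau>..0}"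
      by (auto simp: image_iff intro!: bexI[of _ "_ - p"])
    then show ?thesis by (simp only: image_image)
  qed
  have bdd: "bdd_above ((\<lambda>r. z (p + r) $ i) ` {-\<tau>..0})"
    if "continuous_on {p - \<tau>..p} z" for z :: "real \<Rightarrow> real^'n" and p
    unfolding img[symmetric]
    using that by (intro bounded_imp_bdd_above compact_imp_bounded compact_continuous_image continuous_intros) auto
  have "\<bar>(SUP r\<in>{-\<tau>..0}. x (t + r) $ i) - (SUP r\<in>{-\<tau>..0}. y (s + r) $ i)\<bar> \<le> e"
  proof (rule cSUP_diff_le)
    show "\<bar>x (t + r) $ i - y (s + r) $ i\<bar> \<le> e" if "r \<in> {-\<tau>..0}" for r
      using component_le_norm_cart[of "x (t + r) - y (s + r)" i] e[OF that] by simp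
  qed (use \<tau> bdd x y in auto)
  then show "\<bar>(maxdel \<tau> x t - maxdel \<tau> y s) $ i\<bar> \<le> e"
    by (simp add: maxdel_def img)
qed

lemma maxdel_diff_le:
  fixes x y :: "real \<Rightarrow> real^'n"
  assumes "0 \<le> \<tau>" "continuous_on {t - \<tau>..t} x" "continuous_on {t - \<tau>..t} y"
    and "\<And>r. r \<in> {t - \<tau>..t} \<Longrightarrow> norm (x r - y r) \<le> e"
  shows "norm (maxdel \<tau> x t - maxdel \<tau> y t) \<le> real CARD('n) * e"
  using assms by (intro maxdel_shift_diff_le) auto

lemma continuous_on_maxdel:
  fixes x :: "real \<Rightarrow> real^'n"
  assumes \<tau>: "0 \<le> \<tau>" and x: "continuous_on {-\<tau>..T} x"
  shows "continuous_on {0..T} (maxdel \<tau> x)"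
  unfolding continuous_on_iff
proof (intro ballI allI impI)
  fix t e :: real assume t: "t \<in> {0..T}" and e: "0 < e"
  \<comment> \<open>The factor 2 makes the final bound \<open>e / 2\<close>, which is strictly below
    \<open>e\<close>.\<close>
  define e' where "e' = e / (2 * real CARD('n))"
  have e': "0 < e'" using e by (simp add: e'_def)
  obtain d where d: "0 < d"
    "\<And>p q. p \<in> {-\<tau>..T} \<Longrightarrow> q \<in> {-\<tau>..T} \<Longrightarrow> dist q p < d \<Longrightarrow> dist (x q) (x p) < e'"
    using compact_uniformly_continuous[OF x compact_Icc] e' unfolding uniformly_continuous_on_def
    by metis
  have "dist (maxdel \<tau> x s) (maxdel \<tau> x t) < e" if s: "s \<in> {0..T}" "dist s t < d" for s
  proof -
    have "norm (maxdel \<tau> x s - maxdel \<tau> x t) \<le> real CARD('n) * e'"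
    proof (rule maxdel_shift_diff_le[OF \<tau>])
      show "norm (x (s + r) - x (t + r)) \<le> e'" if "r \<in> {-\<tau>..0}" for r
        using d(2)[of "t + r" "s + r"] s t that by (auto simp: dist_norm)
    qed (use s t in \<open>auto intro!: continuous_on_subset[OF x]\<close>)
    also have "\<dots> < e" using e by (simp add: e'_def)
    finally show ?thesis by (simp add: dist_norm)
  qed
  then show "\<exists>d>0. \<forall>s\<in>{0..T}. dist s t < d \<longrightarrow> dist (maxdel \<tau> x s) (maxdel \<tau> x t) < e"
    using d(1) by blast
qed

section \<open>States as solutions of an integral equation\<close>

text \<open>Integrating the exponential gains the factor \<open>1 / K\<close>; a large
  \<open>K\<close> thus makes the integral operator contractive on an interval of any
  length.\<close>

lemma norm_integral_exp_bound:
  fixes g :: "real \<Rightarrow> 'a::euclidean_space"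
  assumes t: "0 \<le> t" and K: "0 < K" and B: "0 \<le> B"
    and g: "g integrable_on {0..t}" "\<And>s. s \<in> {0..t} \<Longrightarrow> norm (g s) \<le> A + B * exp (K * s)"
  shows "norm (integral {0..t} g) \<le> A * t + B / K * exp (K * t)"
proof -
  have "((\<lambda>s. A + B * exp (K * s)) has_integral
      (A * t + B / K * exp (K * t)) - (A * 0 + B / K * exp (K * 0))) {0..t}"
    using K by (intro fundamental_theorem_of_calculus t)
      (auto intro!: derivative_eq_intros simp: has_real_derivative_iff_has_vector_derivative[symmetric])
  then have I: "(\<lambda>s. A + B * exp (K * s)) integrable_on {0..t}"
    "integral {0..t} (\<lambda>s. A + B * exp (K * s)) = A * t + B / K * exp (K * t) - B / K"
    by (auto simp: integral_unique has_integral_integrable)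
  have "norm (integral {0..t} g) \<le> integral {0..t} (\<lambda>s. A + B * exp (K * s))"
    by (rule integral_norm_bound_integral[OF g(1) I(1) g(2)])
  then show ?thesis using I(2) K B by (smt (verit) divide_nonneg_pos)
qed

text \<open>The factor \<open>CARD('n)\<close> in \<open>rhs_lip\<close> is the Lipschitz constant obtained for \<^const>\<open>maxdel\<close>, a
  componentwise maximum measured in the Euclidean norm.\<close>

locale delay_control =
  fixes T \<tau> :: real
    and \<phi> :: "real \<Rightarrow> real^'n"
    and F0 :: "real^'n \<Rightarrow> real^'n \<Rightarrow> real^'n"
    and F1 :: "real^'n \<Rightarrow> real^'n \<Rightarrow> real^'m^'n"
    and U :: "(real^'m) set"
    and lip_const C0 :: real
  assumes T_pos: "0 < T" and tau_pos: "0 < \<tau>"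
    and phi_cont: "continuous_on {-\<tau>..0} \<phi>"
    and lip_const_nonneg: "0 \<le> lip_const"
    and rhs_cont: "continuous_on UNIV (\<lambda>(x, v, u). rhs F0 F1 x v u)"
    and rhs_lip: "u \<in> U \<Longrightarrow> norm (x - y) \<le> e \<Longrightarrow> norm (v - w) \<le> real CARD('n) * e \<Longrightarrow>
      norm (rhs F0 F1 x v u - rhs F0 F1 y w u) \<le> lip_const * e"
    and rhs_bound: "u \<in> U \<Longrightarrow> norm (rhs F0 F1 0 0 u) \<le> C0"
    and U_ne: "U \<noteq> {}"
begin

text \<open>Values lie in \<open>U\<close> for every time, not just almost every time, so velocity
  bounds hold without exceptional sets. \<open>feasible_imp_control\<close> provides the passage
  from feasible controls.\<close>

definition control :: "(real \<Rightarrow> real^'m) \<Rightarrow> bool" where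
  "control u \<longleftrightarrow> u \<in> borel_measurable (lebesgue_on {0..T}) \<and> range u \<subseteq> U"

definition velocity :: "(real \<Rightarrow> real^'m) \<Rightarrow> (real \<Rightarrow> real^'n) \<Rightarrow> real \<Rightarrow> real^'n" where
  "velocity u x s = rhs F0 F1 (x s) (maxdel \<tau> x s) (u s)"

text \<open>The integral form of the state equation, which survives limits under dominated
  convergence, whereas almost everywhere derivatives do not.\<close>

definition trajectory :: "(real \<Rightarrow> real^'m) \<Rightarrow> (real \<Rightarrow> real^'n) \<Rightarrow> bool" where
  "trajectory u x \<longleftrightarrow> continuous_on {-\<tau>..T} x \<and> (\<forall>s\<in>{-\<tau>..0}. x s = \<phi> s) \<and>
    (\<forall>t\<in>{0..T}. x t = \<phi> 0 + integral {0..t} (velocity u x))"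

lemma C0_nonneg: "0 \<le> C0"
proof -
  obtain u where "u \<in> U" using U_ne by blast
  then show ?thesis using order_trans[OF norm_ge_zero rhs_bound] by blast
qed

text \<open>Only the window \<open>{s - \<tau>..s}\<close> is consulted, so in weighted estimates
  the growing factor \<open>exp (rate * max 0 r)\<close> can be bounded by its value at the right
  end \<open>s\<close>.\<close>

lemma velocity_diff_le:
  assumes u: "control u" and x: "continuous_on {-\<tau>..T} x" and y: "continuous_on {-\<tau>..T} y"
    and s: "s \<in> {0..T}" and e: "\<And>r. r \<in> {s - \<tau>..s} \<Longrightarrow> norm (x r - y r) \<le> e"
  shows "norm (velocity u x s - velocity u y s) \<le> lip_const * e"
  unfolding velocity_def
proof (rule rhs_lip)
  show "u s \<in> U" using u by (auto simp: control_def)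
  show "norm (x s - y s) \<le> e" using e[of s] tau_pos by simp
  show "norm (maxdel \<tau> x s - maxdel \<tau> y s) \<le> real CARD('n) * e"
    using e s tau_pos
    by (intro maxdel_diff_le) (auto intro!: continuous_on_subset[OF x] continuous_on_subset[OF y])
qed

lemma norm_velocity_le:
  assumes u: "control u" and x: "continuous_on {-\<tau>..T} x"
    and s: "s \<in> {0..T}" and e: "\<And>r. r \<in> {s - \<tau>..s} \<Longrightarrow> norm (x r) \<le> e"
  shows "norm (velocity u x s) \<le> C0 + lip_const * e"
proof -
  \<comment> \<open>The zero path is its own delay maximum; comparison with it turns the Lipschitz
    estimate into linear growth.\<close>
  have "maxdel \<tau> (\<lambda>_. 0) s = (0 :: real^'n)"
    using tau_pos by (simp add: maxdel_def vec_eq_iff)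
  then have "norm (velocity u (\<lambda>_. 0) s) \<le> C0"
    using u rhs_bound by (auto simp: velocity_def control_def)
  moreover have "norm (velocity u x s - velocity u (\<lambda>_. 0) s) \<le> lip_const * e"
    using e by (intro velocity_diff_le u x s) auto
  ultimately show ?thesis
    using norm_triangle_sub[of "velocity u x s" "velocity u (\<lambda>_. 0) s"] by linarith
qed

lemma velocity_measurable:
  assumes u: "control u" and x: "continuous_on {-\<tau>..T} x"
  shows "velocity u x \<in> borel_measurable (lebesgue_on {0..T})"
proof -
  have [measurable]: "u \<in> borel_measurable (lebesgue_on {0..T})"
    using u by (simp add: control_def)
  have [measurable]: "x \<in> borel_measurable (lebesgue_on {0..T})"
    using tau_pos
    by (intro continuous_imp_measurable_on_sets_lebesgue continuous_on_subset[OF x]) auto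
  have [measurable]: "maxdel \<tau> x \<in> borel_measurable (lebesgue_on {0..T})"
    using tau_pos x by (intro continuous_imp_measurable_on_sets_lebesgue continuous_on_maxdel) auto
  have "(\<lambda>s. (x s, maxdel \<tau> x s, u s)) \<in> borel_measurable (lebesgue_on {0..T})"
    by (intro borel_measurable_Pair) measurable
  from borel_measurable_continuous_on[OF rhs_cont this] show ?thesis
    by (simp add: velocity_def[abs_def])
qed

lemma velocity_bounded:
  assumes u: "control u" and x: "continuous_on {-\<tau>..T} x"
  obtains c where "\<And>s. s \<in> {0..T} \<Longrightarrow> norm (velocity u x s) \<le> c"
proof -
  have "bounded (x ` {-\<tau>..T})"
    by (intro compact_imp_bounded compact_continuous_image x) auto
  then obtain R where "\<And>r. r \<in> {-\<tau>..T} \<Longrightarrow> norm (x r) \<le> R"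
    unfolding bounded_iff by blast
  then show thesis
    by (intro that[of "C0 + lip_const * R"] norm_velocity_le u x) auto
qed

lemma velocity_integrable_lebesgue:
  assumes "control u" "continuous_on {-\<tau>..T} x" "t \<in> {0..T}"
  shows "integrable (lebesgue_on {0..t}) (velocity u x)"
proof -
  obtain c where "\<And>s. s \<in> {0..T} \<Longrightarrow> norm (velocity u x s) \<le> c"
    using velocity_bounded[OF assms(1,2)] by blast
  moreover have "velocity u x \<in> borel_measurable (lebesgue_on {0..t})"
    using assms(3) by (intro measurable_restrict_mono[OF velocity_measurable[OF assms(1,2)]]) auto
  ultimately show ?thesis
    using assms(3) by (intro integrable_lebesgue_on_bounded[of _ _ _ c]) auto
qed

lemma velocity_integrable_on:
  assumes "control u" "continuous_on {-\<tau>..T} x" "a \<in> {0..T}" "b \<in> {0..T}"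
  shows "velocity u x integrable_on {a..b}"
proof -
  have "velocity u x integrable_on {0..T}"
    using T_pos by (intro integrable_on_lebesgue_on velocity_integrable_lebesgue assms) auto
  then show ?thesis
    by (rule integrable_subinterval_real) (use assms(3,4) in auto)
qed

text \<open>The Lipschitz clause of \<open>is_state\<close> excludes functions of Cantor type, whose
  almost everywhere derivative does not determine their increments.\<close>

lemma state_imp_trajectory:
  assumes u: "control u" and st: "is_state T \<tau> \<phi> F0 F1 u x"
  shows "trajectory u x"
  unfolding trajectory_def
proof (intro conjI ballI)
  show x: "continuous_on {-\<tau>..T} x" using st by (simp add: is_state_def)
  show "x s = \<phi> s" if "s \<in> {-\<tau>..0}" for s using st that by (simp add: is_state_def)
  then have x0: "x 0 = \<phi> 0" using tau_pos by simp
  obtain l where lip: "l-lipschitz_on {0..T} x" using st by (auto simp: is_state_def)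
  have deriv: "AE t in lebesgue. t \<in> {0<..<T} \<longrightarrow> (x has_vector_derivative velocity u x t) (at t)"
    using st by (simp add: is_state_def velocity_def)
  fix t assume t: "t \<in> {0..T}"
  have "integral {0..t} (velocity u x) = x t - x 0"
  proof (rule lipschitz_AE_derivative_integral)
    show "l-lipschitz_on {0..t} x" using t by (intro lipschitz_on_subset[OF lip]) auto
    show "AE s in lebesgue. s \<in> {0<..<t} \<longrightarrow> (x has_vector_derivative velocity u x s) (at s)"
      using deriv by eventually_elim (use t in auto)
    show "integrable (lebesgue_on {0..t}) (velocity u x)"
      by (rule velocity_integrable_lebesgue[OF u x t])
  qed (use t in auto)
  then show "x t = \<phi> 0 + integral {0..t} (velocity u x)" by (simp add: x0 algebra_simps)
qed

lemma trajectory_diff: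
  assumes u: "control u" and x: "trajectory u x" and st: "s \<in> {0..T}" "t \<in> {0..T}" "s \<le> t"
  shows "x t - x s = integral {s..t} (velocity u x)"
proof -
  have "continuous_on {-\<tau>..T} x" using x by (simp add: trajectory_def)
  then have "integral {0..s} (velocity u x) + integral {s..t} (velocity u x) = integral {0..t} (velocity u x)"
    using st T_pos
    by (intro Henstock_Kurzweil_Integration.integral_combine velocity_integrable_on u) auto
  then show ?thesis using x st by (simp add: trajectory_def algebra_simps)
qed

lemma trajectory_lipschitz:
  assumes u: "control u" and x: "trajectory u x"
    and c: "\<And>s. s \<in> {0..T} \<Longrightarrow> norm (velocity u x s) \<le> c"
  shows "c-lipschitz_on {0..T} x"
proof (rule lipschitz_on_leI)
  show "0 \<le> c" using order_trans[OF norm_ge_zero c[of 0]] T_pos by simp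
  fix s t assume st: "s \<in> {0..T}" "t \<in> {0..T}" "s \<le> t"
  have "continuous_on {-\<tau>..T} x" using x by (simp add: trajectory_def)
  then have "norm (integral {s..t} (velocity u x)) \<le> integral {s..t} (\<lambda>_. c)"
    using st c by (intro integral_norm_bound_integral velocity_integrable_on u) auto
  then show "dist (x s) (x t) \<le> c * dist s t"
    using st trajectory_diff[OF u x st] by (simp add: dist_norm norm_minus_commute[of "x s"] mult.commute)
qed

text \<open>Boundedness of the velocity gives the Lipschitz clause, and Lebesgue differentiation
  gives the differential equation almost everywhere.\<close>

lemma trajectory_imp_state:
  assumes u: "control u" and x: "trajectory u x"
  shows "is_state T \<tau> \<phi> F0 F1 u x"
  unfolding is_state_def
proof (intro conjI)
  show x': "continuous_on {-\<tau>..T} x" "\<forall>s\<in>{-\<tau>..0}. x s = \<phi> s"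
    using x by (auto simp: trajectory_def)
  show "\<exists>L. L-lipschitz_on {0..T} x"
    using velocity_bounded[OF u x'(1)] trajectory_lipschitz[OF u x] by metis
  have "AE t in lebesgue. t \<in> {0<..<T} \<longrightarrow>
      ((\<lambda>t. integral {0..t} (velocity u x)) has_vector_derivative velocity u x t) (at t)"
    using T_pos
    by (intro indefinite_integral_AE_has_vector_derivative velocity_integrable_on u x') auto
  then have "AE t in lebesgue. t \<in> {0<..<T} \<longrightarrow> (x has_vector_derivative velocity u x t) (at t)"
  proof eventually_elim
    case (elim t)
    show ?case
    proof
      assume t: "t \<in> {0<..<T}"
      have "((\<lambda>t. \<phi> 0 + integral {0..t} (velocity u x)) has_vector_derivative velocity u x t) (at t)"
        using elim t by (auto intro!: derivative_eq_intros)
      then show "(x has_vector_derivative velocity u x t) (at t)"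
        by (rule has_vector_derivative_transform_within_open[of _ _ _ "{0<..<T}"])
           (use t x in \<open>auto simp: trajectory_def\<close>)
    qed
  qed
  then show "AE t in lebesgue. t \<in> {0<..<T} \<longrightarrow>
      (x has_vector_derivative rhs F0 F1 (x t) (maxdel \<tau> x t) (u t)) (at t)"
    by (simp add: velocity_def)
qed

section \<open>A uniform bound and existence of trajectories in the weighted norm\<close>

definition rate :: real where
  "rate = 2 * lip_const + 1"

text \<open>The factor 2 in \<open>rate\<close> produces the contraction constant 1/2; the added 1
  keeps \<open>rate\<close> positive when \<open>lip_const\<close> is 0.\<close>

lemma rate: "0 < rate" "lip_const / rate \<le> 1 / 2"
  using lip_const_nonneg by (auto simp: rate_def field_simps)

text \<open>In the norm weighted by \<open>exp (- rate * t)\<close> the integral operator contributes at most half of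
  the norm of its argument, which replaces Gronwall's inequality.\<close>

lemma trajectory_bound:
  obtains R where "\<And>u x t. control u \<Longrightarrow> trajectory u x \<Longrightarrow> t \<in> {-\<tau>..T} \<Longrightarrow> norm (x t) \<le> R"
proof -
  have "bounded (\<phi> ` {-\<tau>..0})"
    by (intro compact_imp_bounded compact_continuous_image phi_cont) auto
  then obtain M where M: "\<And>r. r \<in> {-\<tau>..0} \<Longrightarrow> norm (\<phi> r) \<le> M"
    unfolding bounded_iff by blast
  have M0: "0 \<le> M" using order_trans[OF norm_ge_zero M[of 0]] tau_pos by simp
  have "norm (x t) \<le> 2 * (M + C0 * T) * exp (rate * T)"
    if u: "control u" and x: "trajectory u x" and t: "t \<in> {-\<tau>..T}" for u x t
  proof -
    have x': "continuous_on {-\<tau>..T} x" "\<And>s. s \<in> {-\<tau>..0} \<Longrightarrow> x s = \<phi> s"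
      using x by (auto simp: trajectory_def)
    \<comment> \<open>The term \<open>max 0 t\<close> leaves the prescribed history
      unweighted.\<close>
    define z where "z t = exp (- rate * max 0 t) * norm (x t)" for t
    have xz: "norm (x t) = exp (rate * max 0 t) * z t" for t
      by (simp add: z_def exp_minus)
    have "continuous_on {-\<tau>..T} z"
      unfolding z_def[abs_def] by (intro continuous_intros x')
    then obtain t0 where t0: "t0 \<in> {-\<tau>..T}" "\<And>t. t \<in> {-\<tau>..T} \<Longrightarrow> z t \<le> z t0"
      using continuous_attains_sup[of "{-\<tau>..T}" z] t by fastforce
    have z0: "0 \<le> z t0" by (simp add: z_def)
    have vel: "norm (velocity u x s) \<le> C0 + (lip_const * z t0) * exp (rate * s)" if s: "s \<in> {0..T}" for s
    proof -
      have "norm (x r) \<le> exp (rate * s) * z t0" if "r \<in> {s - \<tau>..s}" for r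
      proof -
        have "norm (x r) \<le> exp (rate * max 0 r) * z t0"
          unfolding xz using t0(2)[of r] that s by (intro mult_left_mono) auto
        also have "\<dots> \<le> exp (rate * s) * z t0"
          using that s rate(1) z0 by (intro mult_right_mono) auto
        finally show ?thesis .
      qed
      from norm_velocity_le[OF u x'(1) s this] show ?thesis by (simp add: ac_simps)
    qed
    \<comment> \<open>At a maximum point of \<open>z\<close> the integral equation bounds the
      maximum by half of itself plus data; the half is then absorbed on the left.\<close>
    have "z t0 \<le> M + C0 * T + z t0 / 2"
    proof (cases "t0 \<le> 0")
      case True
      then show ?thesis
        using M[of t0] x'(2)[of t0] t0(1) C0_nonneg T_pos by (simp add: z_def add_increasing2)
    next
      case False
      then have t0': "t0 \<in> {0..T}" using t0(1) by simp
      have "norm (integral {0..t0} (velocity u x)) \<le> C0 * t0 + (lip_const * z t0) / rate * exp (rate * t0)"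
        using t0' vel rate(1) lip_const_nonneg z0 T_pos
        by (intro norm_integral_exp_bound velocity_integrable_on u x') auto
      also have "\<dots> \<le> C0 * T + z t0 / 2 * exp (rate * t0)"
        using t0' C0_nonneg mult_right_mono[OF rate(2) z0]
        by (intro add_mono mult_left_mono mult_right_mono) (auto simp: field_simps)
      finally have "norm (x t0) \<le> M + (C0 * T + z t0 / 2 * exp (rate * t0))"
        using x t0' M[of 0] tau_pos norm_triangle_ineq[of "\<phi> 0" "integral {0..t0} (velocity u x)"]
        by (simp add: trajectory_def)
      then have "z t0 \<le> exp (- rate * t0) * (M + (C0 * T + z t0 / 2 * exp (rate * t0)))"
        using t0' by (auto simp: z_def intro!: mult_left_mono)
      also have "\<dots> = exp (- rate * t0) * (M + C0 * T) + z t0 / 2"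
        by (simp add: algebra_simps exp_minus)
      also have "\<dots> \<le> 1 * (M + C0 * T) + z t0 / 2"
        using t0' rate(1) M0 C0_nonneg T_pos by (intro add_right_mono mult_right_mono) auto
      finally show ?thesis by simp
    qed
    then have "z t \<le> 2 * (M + C0 * T)" using t0(2)[OF t] by (simp add: field_simps)
    then have "norm (x t) \<le> exp (rate * max 0 t) * (2 * (M + C0 * T))"
      unfolding xz by (intro mult_left_mono) auto
    also have "\<dots> \<le> exp (rate * T) * (2 * (M + C0 * T))"
      using t T_pos rate(1) M0 C0_nonneg by (intro mult_right_mono) auto
    finally show ?thesis by (simp add: ac_simps)
  qed
  then show thesis by (rule that)
qed

text \<open>Banach's fixed point theorem. The unknown \<open>y\<close> is the state multiplied by
  the decaying weight, so the plain sup distance of \<open>y\<close> is the weighted distance of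
  states.\<close>

lemma trajectory_exists:
  assumes u: "control u"
  obtains x where "trajectory u x"
proof -
  define X where "X y s = exp (rate * max 0 s) *\<^sub>R apply_bcontfun y s" for y :: "real \<Rightarrow>\<^sub>C (real^'n)" and s
  \<comment> \<open>The integral operator conjugated by the weight; \<open>min 0 t\<close> and
    \<open>max 0 t\<close> treat history and evolution in one formula.\<close>
  define H where "H y t = exp (- rate * max 0 t) *\<^sub>R
    (\<phi> (min 0 t) + integral {0..max 0 t} (velocity u (X y)))" for y t
  \<comment> \<open>Bounded continuous functions live on the whole line, so time is clamped to
    \<open>{-\<tau>..T}\<close> and the end values are continued.\<close>
  define cl where "cl t = max (-\<tau>) (min T t)" for t
  have cl: "cl t \<in> {-\<tau>..T}" for t using T_pos tau_pos by (auto simp: cl_def)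
  have X_cont: "continuous_on S (X y)" for S y
    unfolding X_def[abs_def] by (intro continuous_intros) (auto intro: continuous_on_apply_bcontfun)
  have H_cont: "continuous_on {-\<tau>..T} (H y)" for y
  proof -
    have "continuous_on {0..T} (\<lambda>t. integral {0..t} (velocity u (X y)))"
      using T_pos by (intro indefinite_integral_continuous_1 velocity_integrable_on u X_cont) auto
    then have "continuous_on {-\<tau>..T} (\<lambda>t. integral {0..max 0 t} (velocity u (X y)))"
      by (rule continuous_on_compose2) (use T_pos in \<open>auto intro!: continuous_intros\<close>)
    moreover have "continuous_on {-\<tau>..T} (\<lambda>t. \<phi> (min 0 t))"
      by (rule continuous_on_compose2[OF phi_cont]) (use tau_pos in \<open>auto intro!: continuous_intros\<close>)
    ultimately show ?thesis
      unfolding H_def[abs_def] by (intro continuous_intros)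
  qed
  define G where "G y = Bcontfun (\<lambda>t. H y (cl t))" for y
  have G: "apply_bcontfun (G y) t = H y (cl t)" for y t
  proof -
    have "continuous_on UNIV (\<lambda>t. H y (cl t))"
      by (rule continuous_on_compose2[OF H_cont]) (use cl in \<open>auto simp: cl_def[abs_def] intro!: continuous_intros\<close>)
    moreover have "bounded (range (\<lambda>t. H y (cl t)))"
      by (rule bounded_subset[OF compact_imp_bounded[OF compact_continuous_image[OF H_cont compact_Icc]]])
         (use cl in blast)
    ultimately have "(\<lambda>t. H y (cl t)) \<in> bcontfun"
      by (simp add: bcontfun_def)
    then show ?thesis by (simp add: G_def Bcontfun_inverse)
  qed
  have "dist (G y) (G z) \<le> 1 / 2 * dist y z" for y z
  proof (rule dist_bound)
    fix t
    define p where "p = max 0 (cl t)"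
    have p: "p \<in> {0..T}" using cl[of t] T_pos by (auto simp: p_def)
    have vel: "norm (velocity u (X y) s - velocity u (X z) s)
        \<le> 0 + lip_const * dist y z * exp (rate * s)" if s: "s \<in> {0..p}" for s
    proof -
      have "norm (velocity u (X y) s - velocity u (X z) s) \<le> lip_const * (exp (rate * s) * dist y z)"
      proof (rule velocity_diff_le[OF u X_cont X_cont])
        fix r assume r: "r \<in> {s - \<tau>..s}"
        have "norm (X y r - X z r) = exp (rate * max 0 r) * dist (apply_bcontfun y r) (apply_bcontfun z r)"
          by (simp add: X_def dist_norm flip: scaleR_diff_right)
        also have "\<dots> \<le> exp (rate * s) * dist y z"
          using r s rate(1) by (intro mult_mono dist_fun_lt_imp_dist_val_lt dist_bounded) auto
        finally show "norm (X y r - X z r) \<le> exp (rate * s) * dist y z" .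
      qed (use s p in auto)
      then show ?thesis by (simp add: ac_simps)
    qed
    have int: "velocity u (X w) integrable_on {0..p}" for w
      using p T_pos by (intro velocity_integrable_on u X_cont) auto
    \<comment> \<open>The terms with \<phi> cancel, leaving only the integrals; the prefactor then
      cancels the exponential in the integral bound.\<close>
    have "dist (apply_bcontfun (G y) t) (apply_bcontfun (G z) t)
        = exp (- rate * p) * norm (integral {0..p} (\<lambda>s. velocity u (X y) s - velocity u (X z) s))"
      unfolding G H_def p_def[symmetric]
      by (simp add: dist_norm integral_diff int flip: scaleR_diff_right)
    also have "\<dots> \<le> exp (- rate * p) * (0 * p + lip_const * dist y z / rate * exp (rate * p))"
      using p rate(1) lip_const_nonneg vel
      by (intro mult_left_mono norm_integral_exp_bound integrable_diff int) auto
    also have "\<dots> = lip_const / rate * dist y z"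
      by (simp add: exp_minus)
    also have "\<dots> \<le> 1 / 2 * dist y z"
      by (intro mult_right_mono rate) auto
    finally show "dist (apply_bcontfun (G y) t) (apply_bcontfun (G z) t) \<le> 1 / 2 * dist y z" .
  qed
  then obtain y where y: "G y = y"
    using banach_fix_type[of "1/2" G] by auto
  have X_eq: "X y t = \<phi> (min 0 t) + integral {0..max 0 t} (velocity u (X y))" if "t \<in> {-\<tau>..T}" for t
  proof -
    have "cl t = t" using that by (auto simp: cl_def)
    then have "X y t = exp (rate * max 0 t) *\<^sub>R H y t"
      using G[of y t] by (simp add: X_def y)
    then show ?thesis by (simp add: H_def exp_minus)
  qed
  have "trajectory u (X y)"
    unfolding trajectory_def using X_cont X_eq T_pos tau_pos by (auto simp: min_def max_def)
  then show thesis by (rule that)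
qed

end

section \<open>Lower semicontinuity of the cost\<close>

text \<open>Moving every \<open>X i\<close> to \<open>x\<close> costs at most
  \<open>B * norm (X i - x)\<close>, uniformly in the control; after that Jensen's inequality
  applies at the fixed state \<open>x\<close>. The values \<open>f (X i) (u i)\<close> themselves
  need not converge.\<close>

lemma convex_combination_liminf_le:
  fixes f :: "'a::euclidean_space \<Rightarrow> 'b::euclidean_space \<Rightarrow> real"
  assumes U: "compact U" and conv: "\<And>x. convex_on UNIV (f x)" and nonneg: "\<And>x u. 0 \<le> f x u"
    and diff: "\<And>x u. ((\<lambda>y. f y u) has_derivative (\<lambda>h. Df x u \<bullet> h)) (at x)"
    and Df: "continuous_on UNIV (\<lambda>(x, u). Df x u)"
    and X: "X \<longlonglongrightarrow> x" and u: "\<And>i. u i \<in> U"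
    and w: "\<And>k. conv_weights k (N k) (w k)"
    and lim: "(\<lambda>k. \<Sum>i=k..N k. w k i *\<^sub>R u i) \<longlonglongrightarrow> u'"
  shows "ennreal (f x u') \<le> liminf (\<lambda>k. ennreal (\<Sum>i=k..N k. w k i * f (X i) (u i)))"
proof -
  \<comment> \<open>One closed ball contains all \<open>X i\<close>; its product with
    \<open>U\<close> is compact and the ball is convex, as the mean value inequality needs.\<close>
  obtain R where R: "\<And>i. dist x (X i) \<le> R"
    using convergent_imp_bounded[OF X] bounded_any_center[of "range X" x] by auto
  have "bounded ((\<lambda>(x, u). Df x u) ` (cball x R \<times> U))"
    by (intro compact_imp_bounded compact_continuous_image continuous_on_subset[OF Df] compact_Times U) auto
  then obtain b where "\<forall>z\<in>(\<lambda>(x, u). Df x u) ` (cball x R \<times> U). norm z \<le> b"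
    unfolding bounded_iff by blast
  then obtain B where B: "\<And>y v. y \<in> cball x R \<Longrightarrow> v \<in> U \<Longrightarrow> norm (Df y v) \<le> B"
    by force
  have lip: "\<bar>f (X i) (u i) - f x (u i)\<bar> \<le> B * norm (X i - x)" for i
  proof -
    have "norm (f (X i) (u i) - f x (u i)) \<le> B * norm (X i - x)"
    proof (rule differentiable_bound[of "cball x R" "\<lambda>y. f y (u i)"])
      show "((\<lambda>y. f y (u i)) has_derivative (\<lambda>h. Df y (u i) \<bullet> h)) (at y within cball x R)" for y
        by (rule has_derivative_at_withinI[OF diff])
      show "onorm (\<lambda>h. Df y (u i) \<bullet> h) \<le> B" if "y \<in> cball x R" for y
      proof (rule onorm_le)
        fix h
        have "norm (Df y (u i) \<bullet> h) \<le> norm (Df y (u i)) * norm h"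
          using Cauchy_Schwarz_ineq2 by simp
        also have "\<dots> \<le> B * norm h" by (intro mult_right_mono B that u) auto
        finally show "norm (Df y (u i) \<bullet> h) \<le> B * norm h" .
      qed
    qed (use R[of i] order_trans[OF zero_le_dist R[of i]] in simp_all)
    then show ?thesis by simp
  qed
  have "(\<lambda>i. f (X i) (u i) - f x (u i)) \<longlonglongrightarrow> 0"
  proof (rule tendsto_rabs_zero_cancel, rule tendsto_sandwich[OF _ _ tendsto_const])
    have "(\<lambda>i. B * norm (X i - x)) \<longlonglongrightarrow> B * norm (x - x)"
      by (intro tendsto_intros X)
    then show "(\<lambda>i. B * norm (X i - x)) \<longlonglongrightarrow> 0" by simp
  qed (use lip in auto)
  from conv_weights_tendsto[OF w this]
  have err: "(\<lambda>k. \<Sum>i=k..N k. w k i * (f (X i) (u i) - f x (u i))) \<longlonglongrightarrow> 0"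
    by simp
  have "continuous_on UNIV (f x)"
    by (intro convex_on_continuous conv) auto
  then have "(\<lambda>k. f x (\<Sum>i=k..N k. w k i *\<^sub>R u i)) \<longlonglongrightarrow> f x u'"
    by (rule continuous_on_tendsto_compose[OF _ lim]) auto
  \<comment> \<open>The sum may be negative for some \<open>k\<close>; \<open>ennreal\<close> then
    truncates it to 0, which is compatible with limits and inequalities.\<close>
  from tendsto_add[OF this err]
  have "(\<lambda>k. ennreal (f x (\<Sum>i=k..N k. w k i *\<^sub>R u i) +
      (\<Sum>i=k..N k. w k i * (f (X i) (u i) - f x (u i))))) \<longlonglongrightarrow> ennreal (f x u')"
    by (intro tendsto_ennrealI) simp
  then have "ennreal (f x u') = liminf (\<lambda>k. ennreal (f x (\<Sum>i=k..N k. w k i *\<^sub>R u i) +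
      (\<Sum>i=k..N k. w k i * (f (X i) (u i) - f x (u i)))))"
    by (intro lim_imp_Liminf[symmetric]) auto
  also have "\<dots> \<le> liminf (\<lambda>k. ennreal (\<Sum>i=k..N k. w k i * f (X i) (u i)))"
  proof (intro Liminf_mono always_eventually allI ennreal_leI)
    fix k
    have "{k..N k} \<noteq> {}" using w[of k] by (metis conv_weights_def sum.empty zero_neq_one)
    then have "f x (\<Sum>i=k..N k. w k i *\<^sub>R u i) \<le> (\<Sum>i=k..N k. w k i * f x (u i))"
      using w[of k] by (intro convex_on_sum[OF _ _ conv]) (auto simp: conv_weights_def)
    then show "f x (\<Sum>i=k..N k. w k i *\<^sub>R u i) + (\<Sum>i=k..N k. w k i * (f (X i) (u i) - f x (u i)))
        \<le> (\<Sum>i=k..N k. w k i * f (X i) (u i))"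
      by (simp add: right_diff_distrib sum_subtractf)
  qed
  finally show ?thesis .
qed

lemma cost_eq_nn_integral:
  "cost T j x u = (\<integral>\<^sup>+t. ennreal (j t (x t) (u t)) \<partial>lebesgue_on {0..T})"
  by (simp add: cost_def nn_integral_restrict_space)

lemma normal_integrand_measurable:
  assumes j: "normal_integrand T j"
    and [measurable]: "x \<in> borel_measurable (lebesgue_on {0..T})" "u \<in> borel_measurable (lebesgue_on {0..T})"
  shows "(\<lambda>t. j t (x t) (u t)) \<in> borel_measurable (lebesgue_on {0..T})"
proof -
  have "(\<lambda>t. (t, x t, u t)) \<in> lebesgue_on {0..T} \<rightarrow>\<^sub>M lebesgue_on {0..T} \<Otimes>\<^sub>M (borel \<Otimes>\<^sub>M borel)"
    by (intro measurable_Pair measurable_ident) measurable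
  moreover have "(\<lambda>(t, x, u). j t x u) \<in> borel_measurable (lebesgue_on {0..T} \<Otimes>\<^sub>M (borel \<Otimes>\<^sub>M borel))"
    using j unfolding normal_integrand_def by (rule conjunct1)
  ultimately have "(\<lambda>t. case (t, x t, u t) of (t, x, u) \<Rightarrow> j t x u) \<in> borel_measurable (lebesgue_on {0..T})"
    by (rule measurable_compose)
  then show ?thesis by simp
qed

text \<open>Fatou's lemma is applied to the combined integrands. As \<open>c k\<close> bounds every
  cost from index \<open>k\<close> on, it also bounds the combination at stage
  \<open>k\<close>.\<close>

lemma cost_le_of_convex_combinations:
  fixes j :: "real \<Rightarrow> real^'n \<Rightarrow> real^'m \<Rightarrow> real"
  assumes j: "normal_integrand T j"
    and nonneg: "\<And>t x u. t \<in> {0..T} \<Longrightarrow> 0 \<le> j t x u"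
    and conv: "\<And>t x. t \<in> {0..T} \<Longrightarrow> convex_on UNIV (j t x)"
    and diff: "\<And>t x u. t \<in> {0..T} \<Longrightarrow> ((\<lambda>y. j t y u) has_derivative (\<lambda>h. Dj t x u \<bullet> h)) (at x)"
    and Dj: "\<And>t. t \<in> {0..T} \<Longrightarrow> continuous_on UNIV (\<lambda>(x, u). Dj t x u)"
    and U: "compact U" and u: "\<And>i t. u i t \<in> U"
    and [measurable]: "\<And>i. u i \<in> borel_measurable (lebesgue_on {0..T})"
      "\<And>i. X i \<in> borel_measurable (lebesgue_on {0..T})"
    and X: "\<And>t. t \<in> {0..T} \<Longrightarrow> (\<lambda>i. X i t) \<longlonglongrightarrow> x t"
    and w: "\<And>k. conv_weights k (N k) (w k)"
    and lim: "AE t in lebesgue_on {0..T}. (\<lambda>k. \<Sum>i=k..N k. w k i *\<^sub>R u i t) \<longlonglongrightarrow> u' t"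
    and c: "\<And>k i. k \<le> i \<Longrightarrow> cost T j (X i) (u i) \<le> c k" and cm: "c \<longlonglongrightarrow> m"
  shows "cost T j x u' \<le> m"
proof -
  define g where "g i t = j t (X i t) (u i t)" for i t
  have g_meas[measurable]: "g i \<in> borel_measurable (lebesgue_on {0..T})" for i
    unfolding g_def[abs_def] by (intro normal_integrand_measurable j) measurable
  have "cost T j x u' \<le> (\<integral>\<^sup>+t. liminf (\<lambda>k. ennreal (\<Sum>i=k..N k. w k i * g i t)) \<partial>lebesgue_on {0..T})"
    unfolding cost_eq_nn_integral
  proof (rule nn_integral_mono_AE)
    show "AE t in lebesgue_on {0..T}.
        ennreal (j t (x t) (u' t)) \<le> liminf (\<lambda>k. ennreal (\<Sum>i=k..N k. w k i * g i t))"
      using lim AE_space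
    proof eventually_elim
      case (elim t)
      then have t: "t \<in> {0..T}" by simp
      show ?case
        unfolding g_def
        by (rule convex_combination_liminf_le[OF U conv[OF t] nonneg[OF t] diff[OF t] Dj[OF t] X[OF t] u w elim(1)])
    qed
  qed
  also have "\<dots> \<le> liminf (\<lambda>k. \<integral>\<^sup>+t. ennreal (\<Sum>i=k..N k. w k i * g i t) \<partial>lebesgue_on {0..T})"
    by (rule nn_integral_liminf) measurable
  also have "\<dots> \<le> liminf c"
  proof (intro Liminf_mono always_eventually allI)
    fix k
    have w_nonneg: "0 \<le> w k i" for i using w[of k] by (simp add: conv_weights_def)
    have "(\<integral>\<^sup>+t. ennreal (\<Sum>i=k..N k. w k i * g i t) \<partial>lebesgue_on {0..T})
        = (\<integral>\<^sup>+t. (\<Sum>i=k..N k. ennreal (w k i) * ennreal (g i t)) \<partial>lebesgue_on {0..T})"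
      using w_nonneg nonneg
      by (intro nn_integral_cong) (auto simp: g_def simp flip: ennreal_mult)
    also have "\<dots> = (\<Sum>i=k..N k. ennreal (w k i) * cost T j (X i) (u i))"
      by (simp add: nn_integral_sum nn_integral_cmult cost_eq_nn_integral g_def[symmetric])
    also have "\<dots> \<le> (\<Sum>i=k..N k. ennreal (w k i) * c k)"
      by (intro sum_mono mult_left_mono c) auto
    also have "\<dots> = ennreal (\<Sum>i=k..N k. w k i) * c k"
      using w_nonneg by (simp flip: sum_distrib_right)
    also have "\<dots> = c k" using w[of k] by (simp add: conv_weights_def)
    finally show "(\<integral>\<^sup>+t. ennreal (\<Sum>i=k..N k. w k i * g i t) \<partial>lebesgue_on {0..T}) \<le> c k" .
  qed
  also have "liminf c = m" using cm by (intro lim_imp_Liminf) auto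
  finally show ?thesis .
qed

section \<open>Compactness of the set of trajectories\<close>

context delay_control begin

lemma trajectory_sequentially_compact:
  assumes u: "\<And>n. control (u n)" and x: "\<And>n. trajectory (u n) (x n)"
  obtains X k where "continuous_on {-\<tau>..T} X" "strict_mono (k :: nat \<Rightarrow> nat)"
    "\<And>e. 0 < e \<Longrightarrow> \<exists>m. \<forall>n t. m \<le> n \<and> t \<in> {-\<tau>..T} \<longrightarrow> norm (x (k n) t - X t) < e"
proof -
  obtain R where R: "\<And>u x t. control u \<Longrightarrow> trajectory u x \<Longrightarrow> t \<in> {-\<tau>..T} \<Longrightarrow> norm (x t) \<le> R"
    by (rule trajectory_bound) blast
  have x_cont: "continuous_on {-\<tau>..T} (x n)" for n using x by (simp add: trajectory_def)
  define c where "c = C0 + lip_const * R"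
  have lip: "c-lipschitz_on {0..T} (x n)" for n
  proof (rule trajectory_lipschitz[OF u x])
    show "norm (velocity (u n) (x n) s) \<le> c" if "s \<in> {0..T}" for s
      unfolding c_def using that by (intro norm_velocity_le u x_cont R[OF u x]) auto
  qed
  define p where "p t = \<phi> (min 0 t)" for t
  have p_cont: "continuous_on {-\<tau>..T} p"
    unfolding p_def
    by (rule continuous_on_compose2[OF phi_cont]) (use tau_pos in \<open>auto intro!: continuous_intros\<close>)
  \<comment> \<open>A splitting into the common history and a part with a common Lipschitz constant,
    which yields equicontinuity.\<close>
  have x_eq: "x n t = p t + x n (max 0 t) - \<phi> 0" if "t \<in> {-\<tau>..T}" for n t
    using x[of n] that tau_pos by (auto simp: trajectory_def p_def min_def max_def)
  show thesis
  proof (rule Arzela_Ascoli[of "{-\<tau>..T}" x R])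
    show "norm (x n t) \<le> R" if "t \<in> {-\<tau>..T}" for n t by (rule R[OF u x that])
    show "\<exists>d>0. \<forall>n s. s \<in> {-\<tau>..T} \<and> norm (t - s) < d \<longrightarrow> norm (x n t - x n s) < e"
      if t: "t \<in> {-\<tau>..T}" and e: "0 < e" for t e
    proof -
      obtain d where d: "0 < d" "\<And>s. s \<in> {-\<tau>..T} \<Longrightarrow> dist s t < d \<Longrightarrow> dist (p s) (p t) < e / 2"
        using p_cont t e unfolding continuous_on_iff by (metis half_gt_zero)
      have c: "0 \<le> c" using lip lipschitz_on_nonneg by blast
      \<comment> \<open>\<open>c\<close> may be 0, hence \<open>c + 1\<close> in the denominator;
        each of the two parts is allowed \<open>e / 2\<close>.\<close>
      define d' where "d' = min d (e / (2 * (c + 1)))"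
      have "0 < d'" using d(1) c e by (simp add: d'_def)
      moreover have "norm (x n t - x n s) < e" if s: "s \<in> {-\<tau>..T}" "norm (t - s) < d'" for n s
      proof -
        have "norm (x n (max 0 t) - x n (max 0 s)) \<le> c * \<bar>max 0 t - max 0 s\<bar>"
          using lipschitz_onD[OF lip, of "max 0 t" "max 0 s"] s t T_pos by (simp add: dist_norm)
        also have "\<dots> \<le> c * (e / (2 * (c + 1)))"
          using s(2) c by (intro mult_left_mono) (auto simp: d'_def)
        also have "\<dots> \<le> e / 2"
          using c e by (simp add: divide_simps)
        finally have 1: "norm (x n (max 0 t) - x n (max 0 s)) \<le> e / 2" .
        have 2: "norm (p t - p s) < e / 2"
          using d(2)[of s] s by (simp add: dist_norm d'_def norm_minus_commute[of t] norm_minus_commute[of "p t"] abs_minus_commute[of t])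
        have "x n t - x n s = (p t - p s) + (x n (max 0 t) - x n (max 0 s))"
          using x_eq[OF t] x_eq[OF s(1)] by simp
        then show ?thesis
          using norm_triangle_ineq[of "p t - p s" "x n (max 0 t) - x n (max 0 s)"] 1 2 by simp
      qed
      ultimately show ?thesis by blast
    qed
  next
    fix g and k :: "nat \<Rightarrow> nat"
    assume "continuous_on {-\<tau>..T} g" "strict_mono k"
      "\<And>e. 0 < e \<Longrightarrow> \<exists>N. \<forall>n t. N \<le> n \<and> t \<in> {-\<tau>..T} \<longrightarrow> norm (x (k n) t - g t) < e"
    then show thesis by (rule that)
  qed auto
qed

text \<open>The velocity is affine in the control, so taking convex combinations of the integral
  equations commutes with the limit although the controls themselves need not converge.\<close>

lemma trajectory_closed:
  assumes affine: "\<And>k N w v y z. conv_weights k N w \<Longrightarrow>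
      rhs F0 F1 y z (\<Sum>i=k..N. w i *\<^sub>R v i) = (\<Sum>i=k..N. w i *\<^sub>R rhs F0 F1 y z (v i))"
    and u: "\<And>n. control (u n)" and x: "\<And>n. trajectory (u n) (x n)"
    and X: "continuous_on {-\<tau>..T} X"
    and conv: "\<And>e. 0 < e \<Longrightarrow> \<exists>m. \<forall>n t. m \<le> n \<and> t \<in> {-\<tau>..T} \<longrightarrow> norm (x n t - X t) < e"
    and w: "\<And>k. conv_weights k (N k) (w k)"
    and lim: "AE t in lebesgue_on {0..T}. (\<lambda>k. \<Sum>i=k..N k. w k i *\<^sub>R u i t) \<longlonglongrightarrow> u' t"
    and u': "control u'"
  shows "trajectory u' X"
proof -
  have x_cont: "continuous_on {-\<tau>..T} (x n)" for n using x by (simp add: trajectory_def)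
  have pointwise: "(\<lambda>n. x n t) \<longlonglongrightarrow> X t" if "t \<in> {-\<tau>..T}" for t
    using conv that by (intro LIMSEQ_I) blast
  have x_phi: "x n s = \<phi> s" if "s \<in> {-\<tau>..0}" for n s
    using x that by (simp add: trajectory_def)
  have X_phi: "X s = \<phi> s" if s: "s \<in> {-\<tau>..0}" for s
  proof (rule LIMSEQ_unique[OF pointwise])
    show "s \<in> {-\<tau>..T}" using s T_pos by simp
    show "(\<lambda>n. x n s) \<longlonglongrightarrow> \<phi> s" using x_phi[OF s] by simp
  qed
  obtain R where R: "\<And>u x t. control u \<Longrightarrow> trajectory u x \<Longrightarrow> t \<in> {-\<tau>..T} \<Longrightarrow> norm (x t) \<le> R"
    by (rule trajectory_bound) blast
  define c where "c = C0 + lip_const * R"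
  have vel: "norm (velocity (u n) (x n) s) \<le> c" if "s \<in> {0..T}" for n s
    unfolding c_def using that by (intro norm_velocity_le u x_cont R[OF u x]) auto
  define g where "g k s = (\<Sum>i=k..N k. w k i *\<^sub>R velocity (u i) (x i) s)" for k s
  have g_bound: "norm (g k s) \<le> c" if "s \<in> {0..T}" for k s
    using conv_weights_mem_convex[OF w convex_cball[of 0 c], of k "\<lambda>i. velocity (u i) (x i) s"] vel[OF that]
    by (simp add: g_def)
  have g_lim: "AE s in lebesgue_on {0..T}. (\<lambda>k. g k s) \<longlonglongrightarrow> velocity u' X s"
    using lim AE_space
  proof eventually_elim
    case (elim s)
    then have s: "s \<in> {0..T}" by simp
    \<comment> \<open>The state is replaced by its limit under an unchanged control. The Lipschitz
      constant is the same for all controls, so the error vanishes although \<open>u n s\<close> may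
      oscillate.\<close>
    have "(\<lambda>n. velocity (u n) (x n) s - velocity (u n) X s) \<longlonglongrightarrow> 0"
    proof (rule LIMSEQ_I)
      fix e :: real assume e: "0 < e"
      define e' where "e' = e / (lip_const + 1)"
      have e': "0 < e'" "lip_const * e' < e"
        using e lip_const_nonneg by (auto simp: e'_def divide_simps)
      obtain m where m: "\<And>n t. m \<le> n \<Longrightarrow> t \<in> {-\<tau>..T} \<Longrightarrow> norm (x n t - X t) < e'"
        using conv[OF e'(1)] by blast
      have "norm (velocity (u n) (x n) s - velocity (u n) X s) < e" if n: "m \<le> n" for n
      proof -
        have "norm (x n r - X r) \<le> e'" if "r \<in> {s - \<tau>..s}" for r
          using m[OF n, of r] that s by simp
        from velocity_diff_le[OF u x_cont X s this] show ?thesis using e'(2) by (rule le_less_trans)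
      qed
      then show "\<exists>m. \<forall>n\<ge>m. norm (velocity (u n) (x n) s - velocity (u n) X s - 0) < e"
        by auto
    qed
    from conv_weights_tendsto[OF w this]
    have 1: "(\<lambda>k. g k s - (\<Sum>i=k..N k. w k i *\<^sub>R velocity (u i) X s)) \<longlonglongrightarrow> 0"
      by (simp add: g_def scaleR_diff_right sum_subtractf)
    \<comment> \<open>With the state frozen at \<open>X\<close>, the affine dependence moves the
      combination inside, where the combined controls converge.\<close>
    have 2: "(\<lambda>k. \<Sum>i=k..N k. w k i *\<^sub>R velocity (u i) X s) \<longlonglongrightarrow> velocity u' X s"
    proof -
      have "(\<lambda>k. (X s, maxdel \<tau> X s, \<Sum>i=k..N k. w k i *\<^sub>R u i s)) \<longlonglongrightarrow> (X s, maxdel \<tau> X s, u' s)"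
        using elim by (intro tendsto_intros)
      from continuous_on_tendsto_compose[OF rhs_cont this]
      have "(\<lambda>k. rhs F0 F1 (X s) (maxdel \<tau> X s) (\<Sum>i=k..N k. w k i *\<^sub>R u i s)) \<longlonglongrightarrow> velocity u' X s"
        by (simp add: velocity_def)
      then show ?thesis by (simp add: velocity_def affine[OF w])
    qed
    show ?case using tendsto_add[OF 1 2] by simp
  qed
  have "X t = \<phi> 0 + integral {0..t} (velocity u' X)" if t: "t \<in> {0..T}" for t
  proof -
    have vel_int: "integrable (lebesgue_on {0..t}) (velocity (u i) (x i))" for i
      by (rule velocity_integrable_lebesgue[OF u x_cont t])
    have g_int: "integrable (lebesgue_on {0..t}) (g k)" for k
      unfolding g_def[abs_def] using vel_int by simp
    have lim_int: "integrable (lebesgue_on {0..t}) (velocity u' X)"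
      by (rule velocity_integrable_lebesgue[OF u' X t])
    \<comment> \<open>The combined integral equations: the right side is a tail combination of a
      convergent sequence, so it inherits the limit.\<close>
    have "integral {0..t} (g k) = (\<Sum>i=k..N k. w k i *\<^sub>R (x i t - \<phi> 0))" for k
    proof -
      have "integral\<^sup>L (lebesgue_on {0..t}) (g k)
          = (\<Sum>i=k..N k. w k i *\<^sub>R integral\<^sup>L (lebesgue_on {0..t}) (velocity (u i) (x i)))"
        unfolding g_def[abs_def] using vel_int by simp
      moreover have "integral\<^sup>L (lebesgue_on {0..t}) (velocity (u i) (x i)) = x i t - \<phi> 0" for i
        using lebesgue_integral_eq_integral[OF vel_int[of i]] x[of i] t by (simp add: trajectory_def)
      ultimately show ?thesis
        using lebesgue_integral_eq_integral[OF g_int[of k]] by simp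
    qed
    moreover have "(\<lambda>k. \<Sum>i=k..N k. w k i *\<^sub>R (x i t - \<phi> 0)) \<longlonglongrightarrow> X t - \<phi> 0"
      using t tau_pos by (intro conv_weights_tendsto w tendsto_intros pointwise) auto
    moreover have "(\<lambda>k. integral {0..t} (g k)) \<longlonglongrightarrow> integral {0..t} (velocity u' X)"
    proof -
      have "(\<lambda>k. integral\<^sup>L (lebesgue_on {0..t}) (g k)) \<longlonglongrightarrow> integral\<^sup>L (lebesgue_on {0..t}) (velocity u' X)"
      proof (rule integral_dominated_convergence[where w = "\<lambda>_. c"])
        show "AE s in lebesgue_on {0..t}. (\<lambda>k. g k s) \<longlonglongrightarrow> velocity u' X s"
          using g_lim t by (auto simp: AE_restrict_space_iff elim: eventually_mono)
        show "AE s in lebesgue_on {0..t}. norm (g k s) \<le> c" for k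
          using g_bound t by (intro AE_I2) auto
      qed (use g_int lim_int in auto)
      then show ?thesis
        by (simp add: lebesgue_integral_eq_integral g_int lim_int)
    qed
    ultimately have "X t - \<phi> 0 = integral {0..t} (velocity u' X)"
      using LIMSEQ_unique by force
    then show ?thesis by (simp add: algebra_simps)
  qed
  then show ?thesis using X X_phi by (simp add: trajectory_def)
qed

end

section \<open>Existence of an optimal control\<close>

lemma norm_matrix_vector_mult_le:
  fixes A :: "real^'m^'n"
  shows "norm (A *v u) \<le> norm A * norm u"
proof -
  have "norm (A *v u) = L2_set (\<lambda>i. \<bar>A $ i \<bullet> u\<bar>) UNIV"
    by (simp add: norm_vec_def matrix_vector_mult_def inner_vec_def)
  also have "\<dots> \<le> L2_set (\<lambda>i. norm u * norm (A $ i)) UNIV"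
    by (intro L2_set_mono) (auto simp: mult.commute[of "norm u"] Cauchy_Schwarz_ineq2)
  also have "\<dots> = norm u * L2_set (\<lambda>i. norm (A $ i)) UNIV"
    by (rule L2_set_right_distrib[symmetric]) simp
  also have "\<dots> = norm A * norm u"
    by (simp add: norm_vec_def[of A])
  finally show ?thesis .
qed

lemma bounded_bilinear_matrix_vector_mult:
  "bounded_bilinear ((*v) :: real^'m^'n \<Rightarrow> real^'m \<Rightarrow> real^'n)"
proof
  show "\<exists>K. \<forall>(A :: real^'m^'n) u. norm (A *v u) \<le> norm A * norm u * K"
    using norm_matrix_vector_mult_le by (intro exI[of _ 1]) auto
qed (auto simp: matrix_vector_mult_add_rdistrib matrix_vector_right_distrib
    scaleR_matrix_vector_assoc matrix_vector_mult_scaleR)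

lemma rhs_convex_combination:
  assumes "conv_weights k N w"
  shows "rhs F0 F1 x v (\<Sum>i=k..N. w i *\<^sub>R u i) = (\<Sum>i=k..N. w i *\<^sub>R rhs F0 F1 x v (u i))"
proof -
  interpret bounded_bilinear "(*v) :: real^'b^'a \<Rightarrow> real^'b \<Rightarrow> real^'a"
    by (rule bounded_bilinear_matrix_vector_mult)
  \<comment> \<open>The weights sum to 1, so the drift can be distributed over the
    combination.\<close>
  have "F0 x v = (\<Sum>i=k..N. w i *\<^sub>R F0 x v)"
    using assms by (simp add: conv_weights_def flip: scaleR_left.sum)
  then show ?thesis
    by (simp add: rhs_def sum_right scaleR_right scaleR_add_right sum.distrib)
qed

lemma dist_Pair_le: "dist (x, v) (y, w) \<le> norm (x - y) + norm (v - w)"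
  for x y :: "'a::real_normed_vector" and v w :: "'b::real_normed_vector"
  using norm_Pair_le[of "x - y" "v - w"] by (simp add: dist_norm)

lemma delay_control_rhs:
  fixes F0 :: "real^'n \<Rightarrow> real^'n \<Rightarrow> real^'n" and F1 :: "real^'n \<Rightarrow> real^'n \<Rightarrow> real^'m^'n"
  assumes "0 < T" "0 < \<tau>" "continuous_on {-\<tau>..0} \<phi>"
    and F0: "L0-lipschitz_on UNIV (\<lambda>(x, v). F0 x v)" and F1: "L1-lipschitz_on UNIV (\<lambda>(x, v). F1 x v)"
    and "U \<noteq> {}" and U: "compact U"
  shows "\<exists>l c. delay_control T \<tau> \<phi> F0 F1 U l c"
proof -
  interpret bounded_bilinear "(*v) :: real^'m^'n \<Rightarrow> real^'m \<Rightarrow> real^'n"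
    by (rule bounded_bilinear_matrix_vector_mult)
  obtain B0 where "\<forall>u\<in>U. norm u \<le> B0"
    using compact_imp_bounded[OF U] unfolding bounded_iff by blast
  then obtain B where B: "0 \<le> B" "\<And>u. u \<in> U \<Longrightarrow> norm u \<le> B"
    by (metis max.cobounded1 max.coboundedI2)
  have L: "0 \<le> L0" "0 \<le> L1" using F0 F1 lipschitz_on_nonneg by auto
  \<comment> \<open>\<open>B\<close> bounds the controls in \<open>U\<close>; the factor
    \<open>1 + CARD('n)\<close> bounds the distance of the argument pairs, with the second term
    coming from the delay maximum.\<close>
  define l where "l = (L0 + L1 * B) * (1 + real CARD('n))"
  have rhs_cont: "continuous_on UNIV (\<lambda>(x, v, u). rhs F0 F1 x v u)"
  proof -
    have pair: "continuous_on UNIV (\<lambda>p :: (real^'n) \<times> (real^'n) \<times> (real^'m). (fst p, fst (snd p)))"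
      by (intro continuous_intros)
    have "continuous_on UNIV (\<lambda>p :: (real^'n) \<times> (real^'n) \<times> (real^'m). F0 (fst p) (fst (snd p)))"
      using continuous_on_compose2[OF lipschitz_on_continuous_on[OF F0] pair] by simp
    moreover have "continuous_on UNIV (\<lambda>p :: (real^'n) \<times> (real^'n) \<times> (real^'m). F1 (fst p) (fst (snd p)))"
      using continuous_on_compose2[OF lipschitz_on_continuous_on[OF F1] pair] by simp
    ultimately show ?thesis
      unfolding rhs_def case_prod_beta
      by (intro continuous_on_add continuous_on continuous_on_snd continuous_on_id) auto
  qed
  have "bounded ((\<lambda>u. rhs F0 F1 0 0 u) ` U)"
  proof (intro compact_imp_bounded compact_continuous_image U)
    have "continuous_on U (\<lambda>u. (0, 0, u))" by (intro continuous_intros)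
    from continuous_on_compose2[OF rhs_cont this]
    show "continuous_on U (\<lambda>u. rhs F0 F1 0 0 u)" by simp
  qed
  then obtain c where c: "\<And>u. u \<in> U \<Longrightarrow> norm (rhs F0 F1 0 0 u) \<le> c"
    unfolding bounded_iff by blast
  have rhs_lip: "norm (rhs F0 F1 x v u - rhs F0 F1 y w u) \<le> l * e"
    if u: "u \<in> U" and x: "norm (x - y) \<le> e" and v: "norm (v - w) \<le> real CARD('n) * e" for x y v w u e
  proof -
    have d: "dist (x, v) (y, w) \<le> (1 + real CARD('n)) * e"
      using dist_Pair_le[of x v y w] x v by (simp add: algebra_simps)
    have "norm (rhs F0 F1 x v u - rhs F0 F1 y w u) = norm ((F0 x v - F0 y w) + (F1 x v - F1 y w) *v u)"
      by (simp add: rhs_def diff_left algebra_simps)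
    also have "\<dots> \<le> norm (F0 x v - F0 y w) + norm (F1 x v - F1 y w) * norm u"
      by (rule norm_triangle_le) (intro add_left_mono norm_matrix_vector_mult_le)
    also have "\<dots> \<le> L0 * dist (x, v) (y, w) + (L1 * dist (x, v) (y, w)) * B"
      using lipschitz_onD[OF F0, of "(x, v)" "(y, w)"] lipschitz_onD[OF F1, of "(x, v)" "(y, w)"] B u L
      by (intro add_mono mult_mono) (auto simp: dist_norm)
    also have "\<dots> = (L0 + L1 * B) * dist (x, v) (y, w)" by (simp add: algebra_simps)
    also have "\<dots> \<le> (L0 + L1 * B) * ((1 + real CARD('n)) * e)"
      using L B by (intro mult_left_mono d) auto
    finally show ?thesis by (simp add: l_def algebra_simps)
  qed
  have "delay_control T \<tau> \<phi> F0 F1 U l c"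
    by unfold_locales (use assms rhs_cont rhs_lip c L B in \<open>auto simp: l_def\<close>)
  then show ?thesis by blast
qed

section \<open>Passage from feasible controls to controls, and the minimization\<close>

context delay_control begin

lemma feasible_control:
  assumes "control u" "compact U"
  shows "feasible T U u"
proof -
  obtain C where "\<forall>v\<in>U. norm v \<le> C"
    using compact_imp_bounded[OF assms(2)] unfolding bounded_iff by blast
  then show ?thesis
    using assms(1) by (auto simp: feasible_def Linf_def control_def intro!: exI[of _ C] always_eventually)
qed

text \<open>Resetting the control to a fixed element of \<open>U\<close> on a null set alters
  neither the state equation nor the cost.\<close>

lemma feasible_imp_control:
  assumes u: "feasible T U u" and U: "compact U" and st: "is_state T \<tau> \<phi> F0 F1 u x"
  obtains v where "control v" "trajectory v x" "cost T j x v = cost T j x u"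
proof -
  obtain u0 where u0: "u0 \<in> U" using U_ne by blast
  define v where "v t = (if u t \<in> U then u t else u0)" for t
  have [measurable]: "u \<in> borel_measurable (lebesgue_on {0..T})" "U \<in> sets borel"
    using u borel_compact[OF U] by (auto simp: feasible_def Linf_def)
  have v: "control v"
    unfolding control_def v_def[abs_def] using u0 by (intro conjI) (measurable, auto)
  have eq: "AE t in lebesgue. t \<in> {0..T} \<longrightarrow> v t = u t"
    using u by (auto simp: feasible_def v_def elim: eventually_mono)
  have "is_state T \<tau> \<phi> F0 F1 v x"
    unfolding is_state_def
  proof (intro conjI)
    have "AE t in lebesgue. t \<in> {0<..<T} \<longrightarrow>
        (x has_vector_derivative rhs F0 F1 (x t) (maxdel \<tau> x t) (u t)) (at t)"
      using st by (simp add: is_state_def)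
    with eq show "AE t in lebesgue. t \<in> {0<..<T} \<longrightarrow>
        (x has_vector_derivative rhs F0 F1 (x t) (maxdel \<tau> x t) (v t)) (at t)"
      by eventually_elim auto
  qed (use st in \<open>auto simp: is_state_def\<close>)
  moreover have "cost T j x v = cost T j x u"
    unfolding cost_def by (rule nn_integral_cong_AE) (use eq in \<open>eventually_elim, auto simp: indicator_def\<close>)
  ultimately show thesis
    using that v state_imp_trajectory by blast
qed

lemma optimal_control_exists:
  fixes j :: "real \<Rightarrow> real^'n \<Rightarrow> real^'m \<Rightarrow> real"
  assumes U: "compact U" "convex U"
    and j: "normal_integrand T j"
    and nonneg: "\<And>t x u. t \<in> {0..T} \<Longrightarrow> 0 \<le> j t x u"
    and conv: "\<And>t x. t \<in> {0..T} \<Longrightarrow> convex_on UNIV (j t x)"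
    and diff: "\<And>t x u. t \<in> {0..T} \<Longrightarrow> ((\<lambda>y. j t y u) has_derivative (\<lambda>h. Dj t x u \<bullet> h)) (at x)"
    and Dj: "\<And>t. t \<in> {0..T} \<Longrightarrow> continuous_on UNIV (\<lambda>(x, u). Dj t x u)"
  obtains u x where "control u" "trajectory u x"
    "\<And>v y. control v \<Longrightarrow> trajectory v y \<Longrightarrow> cost T j x u \<le> cost T j y v"
proof -
  obtain u0 where u0: "u0 \<in> U" using U_ne by blast
  define S where "S = {cost T j x u |u x. control u \<and> trajectory u x}"
  have "control (\<lambda>_. u0)" using u0 by (auto simp: control_def)
  then obtain x0 where "trajectory (\<lambda>_. u0) x0" by (rule trajectory_exists)
  with \<open>control (\<lambda>_. u0)\<close> have "S \<noteq> {}" by (auto simp: S_def)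
  \<comment> \<open>Monotonicity of \<open>c\<close> is used beyond convergence: it bounds all later
    costs of the subsequence by \<open>c (k n)\<close>.\<close>
  then obtain c where c: "decseq c" "range c \<subseteq> S" "Inf S = (INF i. c i)"
    using ennreal_Inf_countable_INF by blast
  have "\<exists>u x. control u \<and> trajectory u x \<and> cost T j x u = c n" for n
  proof -
    have "c n \<in> S" using c(2) by blast
    then obtain u x where "c n = cost T j x u" "control u" "trajectory u x"
      unfolding S_def by blast
    then show ?thesis by metis
  qed
  then obtain u x where u: "\<And>n. control (u n)" and x: "\<And>n. trajectory (u n) (x n)"
    and cost: "\<And>n. cost T j (x n) (u n) = c n"
    by metis
  have c_lim: "c \<longlonglongrightarrow> Inf S"
    unfolding c(3) by (rule LIMSEQ_INF[OF c(1)])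
  obtain X k where X: "continuous_on {-\<tau>..T} X" and k: "strict_mono (k :: nat \<Rightarrow> nat)"
    and xX: "\<And>e. 0 < e \<Longrightarrow> \<exists>m. \<forall>n t. m \<le> n \<and> t \<in> {-\<tau>..T} \<longrightarrow> norm (x (k n) t - X t) < e"
    by (rule trajectory_sequentially_compact[of u x, OF u x]) (rule that)
  have u_meas[measurable]: "u n \<in> borel_measurable (lebesgue_on {0..T})" for n
    using u by (simp add: control_def)
  have u_U: "u n t \<in> U" for n t using u by (auto simp: control_def)
  obtain B where "\<forall>v\<in>U. norm v \<le> B"
    using compact_imp_bounded[OF U(1)] unfolding bounded_iff by blast
  then have B: "norm (u (k n) t) \<le> B" for n t using u_U by blast
  interpret finite_measure "lebesgue_on {0..T}"
    by (intro finite_measure_lebesgue_on) auto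
  \<comment> \<open>The weights are chosen after the subsequence, so the combined tails run along
    states that already converge.\<close>
  obtain N w where w: "\<And>n. conv_weights n (N n) (w n)"
    and conv_ae: "AE t in lebesgue_on {0..T}. convergent (\<lambda>n. \<Sum>i=n..N n. w n i *\<^sub>R u (k i) t)"
    by (rule convex_combinations_AE_convergent[of "\<lambda>n. u (k n)" B, OF u_meas B]) (rule that)
  define l where "l t = lim (\<lambda>n. \<Sum>i=n..N n. w n i *\<^sub>R u (k i) t)" for t
  \<comment> \<open>\<open>l t\<close> is informative only where the combinations converge; there it
    lies in \<open>U\<close>, which is closed and convex. Elsewhere \<open>u0\<close> may stand
    in.\<close>
  define u' where "u' t = (if l t \<in> U then l t else u0)" for t
  have [measurable]: "l \<in> borel_measurable (lebesgue_on {0..T})"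
    unfolding l_def[abs_def] by measurable
  have [measurable]: "U \<in> sets borel" by (rule borel_compact[OF U(1)])
  have u': "control u'"
    unfolding control_def u'_def[abs_def] using u0 by (intro conjI) (measurable, auto)
  have lim: "AE t in lebesgue_on {0..T}. (\<lambda>n. \<Sum>i=n..N n. w n i *\<^sub>R u (k i) t) \<longlonglongrightarrow> u' t"
    using conv_ae
  proof eventually_elim
    case (elim t)
    then have "(\<lambda>n. \<Sum>i=n..N n. w n i *\<^sub>R u (k i) t) \<longlonglongrightarrow> l t"
      by (simp add: l_def convergent_LIMSEQ_iff)
    moreover have "(\<Sum>i=n..N n. w n i *\<^sub>R u (k i) t) \<in> U" for n
      by (rule conv_weights_mem_convex[OF w U(2) u_U])
    ultimately show ?case
      using closed_sequentially[OF compact_imp_closed[OF U(1)]] by (fastforce simp: u'_def)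
  qed
  have traj: "trajectory u' X"
    by (rule trajectory_closed[where u = "\<lambda>n. u (k n)" and x = "\<lambda>n. x (k n)", OF rhs_convex_combination u x X xX w lim u'])
  have "cost T j X u' \<le> Inf S"
  proof (rule cost_le_of_convex_combinations[where u = "\<lambda>n. u (k n)" and X = "\<lambda>n. x (k n)"
        and c = "\<lambda>n. c (k n)", OF j nonneg conv diff Dj U(1) _ _ _ _ w lim])
    show "u (k i) t \<in> U" for i t by (rule u_U)
    show "u (k i) \<in> borel_measurable (lebesgue_on {0..T})" for i by (rule u_meas)
    show "x (k i) \<in> borel_measurable (lebesgue_on {0..T})" for i
    proof (intro continuous_imp_measurable_on_sets_lebesgue)
      show "continuous_on {0..T} (x (k i))"
        using x[of "k i"] tau_pos by (auto simp: trajectory_def elim: continuous_on_subset)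
    qed auto
    show "(\<lambda>i. x (k i) t) \<longlonglongrightarrow> X t" if "t \<in> {0..T}" for t
    proof -
      have "t \<in> {-\<tau>..T}" using that tau_pos by simp
      then show ?thesis using xX by (intro LIMSEQ_I) blast
    qed
    show "cost T j (x (k i)) (u (k i)) \<le> c (k n)" if "n \<le> i" for n i
      unfolding cost using c(1) k that by (simp add: decseq_def strict_mono_less_eq)
    show "(\<lambda>n. c (k n)) \<longlonglongrightarrow> Inf S"
      using LIMSEQ_subseq_LIMSEQ[OF c_lim k] by (simp add: o_def)
  qed
  then show thesis
    by (intro that[OF u' traj]) (auto simp: S_def intro!: Inf_lower elim!: order_trans)
qed

end

theorem theorem3p4:
  fixes T \<tau> :: real
    and F0 :: "real^'n \<Rightarrow> real^'n \<Rightarrow> real^'n"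
    and F1 :: "real^'n \<Rightarrow> real^'n \<Rightarrow> real^'m^'n"
    and \<phi> :: "real \<Rightarrow> real^'n"
    and U :: "(real^'m) set"
    and j :: "real \<Rightarrow> real^'n \<Rightarrow> real^'m \<Rightarrow> real"
    and Dj :: "real \<Rightarrow> real^'n \<Rightarrow> real^'m \<Rightarrow> real^'n"
  assumes T_pos: "T > 0" and tau_pos: "\<tau> > 0"
    and F0_lip: "\<exists>L. L-lipschitz_on UNIV (\<lambda>(x, v). F0 x v)"
    and F1_lip: "\<exists>L. L-lipschitz_on UNIV (\<lambda>(x, v). F1 x v)"
    and F0_C1: "C1_map (\<lambda>(x, v). F0 x v)"
    and F1_C1: "C1_map (\<lambda>(x, v). F1 x v)"
    and phi_cont: "continuous_on {-\<tau>..0} \<phi>"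
    and U_ne: "U \<noteq> {}" and U_convex: "convex U" and U_compact: "compact U"
    and j_nonneg: "\<forall>t\<in>{0..T}. \<forall>x u. 0 \<le> j t x u"
    and j_normal: "normal_integrand T j"
    and j_convex: "\<forall>t\<in>{0..T}. \<forall>x. convex_on UNIV (\<lambda>u. j t x u)"
    and j_diff: "\<forall>t\<in>{0..T}. \<forall>x u. ((\<lambda>y. j t y u) has_derivative (\<lambda>h. Dj t x u \<bullet> h)) (at x)"
    and Dj_cont: "\<forall>t\<in>{0..T}. continuous_on UNIV (\<lambda>(x, u). Dj t x u)"
  shows "\<exists>u\<^sub>s x\<^sub>s. feasible T U u\<^sub>s \<and> is_state T \<tau> \<phi> F0 F1 u\<^sub>s x\<^sub>s \<and>
           (\<forall>u x. feasible T U u \<and> is_state T \<tau> \<phi> F0 F1 u x \<longrightarrow> cost T j x\<^sub>s u\<^sub>s \<le> cost T j x u)"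
proof -
  obtain l c where "delay_control T \<tau> \<phi> F0 F1 U l c"
    using delay_control_rhs[OF T_pos tau_pos phi_cont _ _ U_ne U_compact] F0_lip F1_lip by blast
  then interpret delay_control T \<tau> \<phi> F0 F1 U l c .
  obtain v y where v: "control v" "trajectory v y"
    and opt: "\<And>u x. control u \<Longrightarrow> trajectory u x \<Longrightarrow> cost T j y v \<le> cost T j x u"
    using optimal_control_exists[OF U_compact U_convex j_normal, of Dj] j_nonneg j_convex j_diff Dj_cont
    by blast
  have "cost T j y v \<le> cost T j x u" if u: "feasible T U u" and x: "is_state T \<tau> \<phi> F0 F1 u x" for u x
  proof -
    obtain u' where "control u'" "trajectory u' x" "cost T j x u' = cost T j x u"
      by (rule feasible_imp_control[OF u U_compact x])
    then show ?thesis using opt[of u' x] by simp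
  qed
  then show ?thesis
    using feasible_control[OF v(1) U_compact] trajectory_imp_state[OF v] by blast
qed

end
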